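(* Let $f\in L^2(\mathbb R_t\times\mathbb R^n_x;H^1(\mathbb R^n_v))\cap L^1(\mathbb R^{1+2n})$ be such that $(\partial_t+v\cdot\nabla_x)f=\nabla_v\cdot S$ in the sense of distributions for some $S\in L^2(\mathbb R^{1+2n};\mathbb R^n)$. Then $$\|f\|_{L^2(\mathbb R^{1+2n})}^{1+\frac{2}{2+4n}}\le C\sqrt{\|\nabla_vf\|_{L^2(\mathbb R^{1+2n})}^2+\|S\|_{L^2(\mathbb R^{1+2n})}^2}\;\|f\|_{L^1(\mathbb R^{1+2n})}^{\frac{2}{2+4n}}$$ for some $C=C(n)>0$.
   Context: Variables $(t,x,v)\in\mathbb R\times\mathbb R^n\times\mathbb R^n$; $\nabla_v$ is the gradient in $v$. *)

theory Defs
  imports "HOL-Analysis.Analysis"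
begin

text \<open>Points of phase space \<open>\<real>_t \<times> \<real>^n_x \<times> \<real>^n_v\<close> are triples \<open>(t, x, v)\<close>;
  the Lebesgue measure on \<open>\<real>^{1+2n}\<close> is \<open>lborel\<close> on this product type.\<close>

type_synonym 'n phase = "real \<times> (real ^ 'n) \<times> (real ^ 'n)"

fun Ck :: "nat \<Rightarrow> ('a::euclidean_space \<Rightarrow> real) set" where
  "Ck 0 = {\<phi>. continuous_on UNIV \<phi>}"
| "Ck (Suc k) = {\<phi>. continuous_on UNIV \<phi> \<and> (\<forall>p. \<phi> differentiable (at p)) \<and>
      (\<forall>b\<in>Basis. (\<lambda>p. frechet_derivative \<phi> (at p) b) \<in> Ck k)}"

definition smooth_fun :: "('a::euclidean_space \<Rightarrow> real) \<Rightarrow> bool" where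
  "smooth_fun \<phi> \<longleftrightarrow> (\<forall>k. \<phi> \<in> Ck k)"

definition test_fun :: "('a::euclidean_space \<Rightarrow> real) \<Rightarrow> bool" where
  "test_fun \<phi> \<longleftrightarrow> smooth_fun \<phi> \<and> compact (closure {p. \<phi> p \<noteq> 0})"

definition L2_fun :: "('a::euclidean_space \<Rightarrow> 'b::real_normed_vector) \<Rightarrow> bool" where
  "L2_fun g \<longleftrightarrow> g \<in> borel_measurable lborel \<and> integrable lborel (\<lambda>p. (norm (g p))\<^sup>2)"

definition L2_norm_fun :: "('a::euclidean_space \<Rightarrow> 'b::real_normed_vector) \<Rightarrow> real" where
  "L2_norm_fun g = sqrt (integral\<^sup>L lborel (\<lambda>p. (norm (g p))\<^sup>2))"

definition L1_norm_fun :: "('a::euclidean_space \<Rightarrow> real) \<Rightarrow> real" where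
  "L1_norm_fun g = integral\<^sup>L lborel (\<lambda>p. \<bar>g p\<bar>)"

definition weak_grad_v :: "('n::finite phase \<Rightarrow> real) \<Rightarrow> ('n phase \<Rightarrow> real ^ 'n) \<Rightarrow> bool" where
  "weak_grad_v f G \<longleftrightarrow> (\<forall>\<phi> e. test_fun \<phi> \<longrightarrow>
     integral\<^sup>L lborel (\<lambda>p. f p * frechet_derivative \<phi> (at p) (0, 0, e))
       = - integral\<^sup>L lborel (\<lambda>p. (G p \<bullet> e) * \<phi> p))"

definition kinetic_eq :: "('n::finite phase \<Rightarrow> real) \<Rightarrow> ('n phase \<Rightarrow> real ^ 'n) \<Rightarrow> bool" where
  "kinetic_eq f S \<longleftrightarrow> (\<forall>\<phi>. test_fun \<phi> \<longrightarrow>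
     integral\<^sup>L lborel (\<lambda>(t, x, v). f (t, x, v) *
        (frechet_derivative \<phi> (at (t, x, v)) (1, 0, 0)
         + frechet_derivative \<phi> (at (t, x, v)) (0, v, 0)))
     = integral\<^sup>L lborel (\<lambda>p. frechet_derivative \<phi> (at p) (0, 0, S p)))"

end

theory Submission
  imports Defs
begin

text \<open>Average \<open>f\<close> against kernels \<open>K\<^sub>r\<close> at scale \<open>(r\<^sup>2, r\<^sup>3, r)\<close> in \<open>(t, x, v)\<close>, translated by the Galilean
  group that leaves \<open>\<partial>\<^sub>t + v \<cdot> \<nabla>\<^sub>x\<close> and \<open>\<nabla>\<^sub>v\<close> invariant. The difference of two consecutive dyadic kernels has
  mean zero, hence is a sum of derivatives of test functions, and the commutator
  \<open>\<nabla>\<^sub>x = [\<nabla>\<^sub>v, \<partial>\<^sub>t + v \<cdot> \<nabla>\<^sub>x]\<close> turns it into \<open>(\<partial>\<^sub>t + v \<cdot> \<nabla>\<^sub>x) A + \<nabla>\<^sub>v \<cdot> B\<close>. Both weak equations then apply with these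
  kernels as test functions and bound the difference of the averages by \<open>r (\<parallel>\<nabla>\<^sub>v f\<parallel> + \<parallel>S\<parallel>)\<close> in \<open>L\<^sup>2\<close>.
  Summing over dyadic scales below \<open>r\<close> gives
  \<open>\<parallel>f\<parallel>\<^sub>2\<^sup>2 \<le> C (r (\<parallel>\<nabla>\<^sub>v f\<parallel> + \<parallel>S\<parallel>) \<parallel>f\<parallel>\<^sub>2 + r\<^sup>-\<^sup>Q \<parallel>f\<parallel>\<^sub>1\<^sup>2)\<close> with the homogeneous dimension \<open>Q = 2 + 4n\<close>, and
  it remains to optimise in \<open>r\<close>.\<close>

subsection \<open>Smooth functions\<close>

text \<open>The averages are not estimated as elements of L^2. They are paired with a dual function
  \<open>\<psi>\<close>, and Young's inequality with a free weight \<open>l\<close> replaces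
  Cauchy-Schwarz. Every bound then contains only squared norms and L^1 norms, so
  \<open>\<psi>\<close> can tend to f, part of the squared norm of f can be absorbed, and
  \<open>l\<close> is chosen only at the end. Duality also settles the convergence of the averages
  at small scales: the averaging is moved onto \<open>\<psi>\<close>, which is continuous. The
  obstacle is to write a mean-zero kernel as derivatives of compactly supported functions. For a
  product of one-dimensional bumps this is explicit: factors are exchanged one at a time, and each
  exchange is a derivative whose potential contains a difference of two smooth steps. The gain of
  one power of r is a count of homogeneity. At scale r a v-derivative costs 1/r and the transport
  operator 1/r^2; the first weak equation removes a v-derivative, the second trades transport for a
  v-derivative.\<close>

abbreviation dderiv :: "'a::euclidean_space \<Rightarrow> ('a \<Rightarrow> real) \<Rightarrow> 'a \<Rightarrow> real" where
  "dderiv b \<phi> \<equiv> \<lambda>p. frechet_derivative \<phi> (at p) b"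

lemma dderiv_eqI: "(\<phi> has_derivative \<phi>') (at p) \<Longrightarrow> frechet_derivative \<phi> (at p) v = \<phi>' v"
  using frechet_derivative_at by metis

lemma dderiv_has_derivative:
  "\<phi> differentiable (at p) \<Longrightarrow> (\<phi> has_derivative frechet_derivative \<phi> (at p)) (at p)"
  using frechet_derivative_works by blast

lemma dderiv_basis_expansion:
  assumes "\<phi> differentiable (at p)"
  shows "frechet_derivative \<phi> (at p) v = (\<Sum>b\<in>Basis. (v \<bullet> b) * dderiv b \<phi> p)"
proof -
  interpret linear "frechet_derivative \<phi> (at p)"
    by (rule linear_frechet_derivative[OF assms])
  have "frechet_derivative \<phi> (at p) (\<Sum>b\<in>Basis. (v \<bullet> b) *\<^sub>R b) = (\<Sum>b\<in>Basis. (v \<bullet> b) * dderiv b \<phi> p)"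
    by (simp add: sum scale)
  then show ?thesis by (simp add: euclidean_representation)
qed

lemma Ck_continuous: "\<phi> \<in> Ck k \<Longrightarrow> continuous_on UNIV \<phi>"
  by (cases k) auto

lemma Ck_SucI:
  assumes "\<And>p. (\<phi> has_derivative \<phi>' p) (at p)" "\<And>b. b \<in> Basis \<Longrightarrow> (\<lambda>p. \<phi>' p b) \<in> Ck k"
  shows "\<phi> \<in> Ck (Suc k)"
proof -
  have d: "\<phi> differentiable (at p)" for p
    using assms(1) differentiable_def by blast
  moreover have "continuous_on UNIV \<phi>"
    using d differentiable_imp_continuous_on differentiable_on_def
    by (metis differentiable_at_withinI)
  moreover have "dderiv b \<phi> = (\<lambda>p. \<phi>' p b)" for b
    using dderiv_eqI[OF assms(1)] by blast
  ultimately show ?thesis using assms(2) by auto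
qed

lemma Ck_SucD:
  assumes "\<phi> \<in> Ck (Suc k)"
  shows "(\<phi> has_derivative frechet_derivative \<phi> (at p)) (at p)"
    and "b \<in> Basis \<Longrightarrow> dderiv b \<phi> \<in> Ck k"
  using assms dderiv_has_derivative by auto

lemma Ck_Suc_subset: "\<phi> \<in> Ck (Suc k) \<Longrightarrow> \<phi> \<in> Ck k"
proof (induction k arbitrary: \<phi>)
  case 0
  then show ?case by simp
next
  case (Suc k)
  show ?case
    by (rule Ck_SucI[OF Ck_SucD(1)[OF Suc.prems]]) (rule Suc.IH[OF Ck_SucD(2)[OF Suc.prems]])
qed

lemma Ck_const: "(\<lambda>p. c) \<in> Ck k"
proof (induction k arbitrary: c)
  case (Suc k)
  show ?case by (rule Ck_SucI[where \<phi>' = "\<lambda>p v. 0"]) (auto intro: Suc.IH)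
qed simp

lemma Ck_add: "\<phi> \<in> Ck k \<Longrightarrow> \<psi> \<in> Ck k \<Longrightarrow> (\<lambda>p. \<phi> p + \<psi> p) \<in> Ck k"
proof (induction k arbitrary: \<phi> \<psi>)
  case 0
  then show ?case by (auto intro: continuous_intros)
next
  case (Suc k)
  show ?case
    by (rule Ck_SucI[OF has_derivative_add[OF Ck_SucD(1)[OF Suc.prems(1)] Ck_SucD(1)[OF Suc.prems(2)]]])
      (rule Suc.IH[OF Ck_SucD(2)[OF Suc.prems(1)] Ck_SucD(2)[OF Suc.prems(2)]])
qed

lemma Ck_mult: "\<phi> \<in> Ck k \<Longrightarrow> \<psi> \<in> Ck k \<Longrightarrow> (\<lambda>p. \<phi> p * \<psi> p) \<in> Ck k"
proof (induction k arbitrary: \<phi> \<psi>)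
  case 0
  then show ?case by (auto intro: continuous_intros)
next
  case (Suc k)
  show ?case
    by (rule Ck_SucI[OF has_derivative_mult[OF Ck_SucD(1)[OF Suc.prems(1)] Ck_SucD(1)[OF Suc.prems(2)]]])
      (intro Ck_add Suc.IH Ck_SucD(2)[OF Suc.prems(1)] Ck_SucD(2)[OF Suc.prems(2)]
        Ck_Suc_subset[OF Suc.prems(1)] Ck_Suc_subset[OF Suc.prems(2)])
qed

lemma Ck_sum: "(\<And>i. i \<in> I \<Longrightarrow> \<phi> i \<in> Ck k) \<Longrightarrow> (\<lambda>p. \<Sum>i\<in>I. \<phi> i p) \<in> Ck k"
  by (induction I rule: infinite_finite_induct) (auto intro: Ck_const Ck_add)

text \<open>The chain rule differentiates \<open>\<phi>\<close> in direction \<open>l b\<close>,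
  which need not lie in \<open>Basis\<close>; expanding it in the basis returns to the derivatives
  that \<open>Ck\<close> speaks of.\<close>

lemma Ck_affine:
  assumes "bounded_linear l"
  shows "\<phi> \<in> Ck k \<Longrightarrow> (\<lambda>p. \<phi> (c + l p)) \<in> Ck k"
proof (induction k arbitrary: \<phi>)
  case 0
  interpret l: bounded_linear l by fact
  have "continuous_on UNIV (\<phi> \<circ> (\<lambda>p. c + l p))"
    using 0 by (intro continuous_on_compose continuous_intros l.continuous_on)
      (auto intro: continuous_on_subset)
  then show ?case by (simp add: o_def)
next
  case (Suc k)
  have "((\<lambda>p. c + l p) has_derivative l) (at p)" for p
    using has_derivative_add[OF has_derivative_const bounded_linear_imp_has_derivative[OF assms]] by simp
  from diff_chain_at[OF this Ck_SucD(1)[OF Suc.prems]]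
  have d: "((\<lambda>p. \<phi> (c + l p)) has_derivative (\<lambda>v. frechet_derivative \<phi> (at (c + l p)) (l v))) (at p)" for p
    by (simp add: o_def)
  have e: "frechet_derivative \<phi> (at q) (l v) = (\<Sum>b\<in>Basis. (l v \<bullet> b) * dderiv b \<phi> q)" for q v
    using Suc.prems by (intro dderiv_basis_expansion) auto
  show ?case
    by (rule Ck_SucI[OF d], unfold e)
      (intro Ck_sum Ck_mult Ck_const Suc.IH[OF Ck_SucD(2)[OF Suc.prems]])
qed

lemma smooth_funI:
  assumes "\<And>p. (\<phi> has_derivative \<phi>' p) (at p)" "\<And>b. b \<in> Basis \<Longrightarrow> smooth_fun (\<lambda>p. \<phi>' p b)"
  shows "smooth_fun \<phi>"
  unfolding smooth_fun_def
proof
  fix k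
  have "(\<lambda>p. \<phi>' p b) \<in> Ck k" if "b \<in> Basis" for b
    using assms(2)[OF that] unfolding smooth_fun_def by blast
  from Ck_SucI[OF assms(1) this] show "\<phi> \<in> Ck k" by (rule Ck_Suc_subset)
qed

lemma smooth_fun_has_derivative:
  "smooth_fun \<phi> \<Longrightarrow> (\<phi> has_derivative frechet_derivative \<phi> (at p)) (at p)"
  using Ck_SucD(1)[of _ 0] unfolding smooth_fun_def by blast

lemma smooth_fun_differentiable: "smooth_fun \<phi> \<Longrightarrow> \<phi> differentiable (at p)"
  using smooth_fun_has_derivative differentiable_def by blast

lemma smooth_fun_continuous: "smooth_fun \<phi> \<Longrightarrow> continuous_on UNIV \<phi>"
  using Ck_continuous unfolding smooth_fun_def by blast

lemma smooth_fun_const [simp]: "smooth_fun (\<lambda>p. c)"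
  by (simp add: smooth_fun_def Ck_const)

lemma smooth_fun_add: "smooth_fun \<phi> \<Longrightarrow> smooth_fun \<psi> \<Longrightarrow> smooth_fun (\<lambda>p. \<phi> p + \<psi> p)"
  by (simp add: smooth_fun_def Ck_add)

lemma smooth_fun_mult: "smooth_fun \<phi> \<Longrightarrow> smooth_fun \<psi> \<Longrightarrow> smooth_fun (\<lambda>p. \<phi> p * \<psi> p)"
  by (simp add: smooth_fun_def Ck_mult)

lemma smooth_fun_sum: "(\<And>i. i \<in> I \<Longrightarrow> smooth_fun (\<phi> i)) \<Longrightarrow> smooth_fun (\<lambda>p. \<Sum>i\<in>I. \<phi> i p)"
  unfolding smooth_fun_def by (intro allI Ck_sum) simp

lemma smooth_fun_prod: "(\<And>i. i \<in> I \<Longrightarrow> smooth_fun (\<phi> i)) \<Longrightarrow> smooth_fun (\<lambda>p. \<Prod>i\<in>I. \<phi> i p)"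
  by (induction I rule: infinite_finite_induct) (auto intro: smooth_fun_mult)

lemma smooth_fun_affine:
  "bounded_linear l \<Longrightarrow> smooth_fun \<phi> \<Longrightarrow> smooth_fun (\<lambda>p. \<phi> (c + l p))"
  unfolding smooth_fun_def by (intro allI Ck_affine) simp_all

lemma smooth_fun_linear:
  assumes "bounded_linear l" shows "smooth_fun l"
  by (rule smooth_funI[OF bounded_linear_imp_has_derivative[OF assms]]) simp

lemma smooth_fun_dderiv:
  assumes "smooth_fun \<phi>" shows "smooth_fun (dderiv v \<phi>)"
proof -
  have "dderiv b \<phi> \<in> Ck k" if "b \<in> Basis" for b k
    by (rule Ck_SucD(2)[OF _ that]) (use assms in \<open>simp add: smooth_fun_def del: Ck.simps\<close>)
  then have "smooth_fun (dderiv b \<phi>)" if "b \<in> Basis" for b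
    using that unfolding smooth_fun_def by blast
  then have "smooth_fun (\<lambda>p. \<Sum>b\<in>Basis. (v \<bullet> b) * dderiv b \<phi> p)"
    by (intro smooth_fun_sum smooth_fun_mult smooth_fun_const)
  moreover have "dderiv v \<phi> = (\<lambda>p. \<Sum>b\<in>Basis. (v \<bullet> b) * dderiv b \<phi> p)"
    by (intro ext dderiv_basis_expansion smooth_fun_differentiable assms)
  ultimately show ?thesis by (rule ssubst[rotated])
qed

lemma dderiv_add:
  "smooth_fun \<phi> \<Longrightarrow> smooth_fun \<psi> \<Longrightarrow> dderiv v (\<lambda>p. \<phi> p + \<psi> p) p = dderiv v \<phi> p + dderiv v \<psi> p"
  by (rule dderiv_eqI[OF has_derivative_add[OF smooth_fun_has_derivative smooth_fun_has_derivative]])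

lemma dderiv_mult:
  "smooth_fun \<phi> \<Longrightarrow> smooth_fun \<psi> \<Longrightarrow>
    dderiv v (\<lambda>p. \<phi> p * \<psi> p) p = \<phi> p * dderiv v \<psi> p + dderiv v \<phi> p * \<psi> p"
  by (rule dderiv_eqI[OF has_derivative_mult[OF smooth_fun_has_derivative smooth_fun_has_derivative]])

lemma dderiv_cmult: "smooth_fun \<phi> \<Longrightarrow> dderiv v (\<lambda>p. c * \<phi> p) p = c * dderiv v \<phi> p"
  by (rule dderiv_eqI[OF has_derivative_mult_right[OF smooth_fun_has_derivative]])

lemma dderiv_sum:
  "(\<And>i. i \<in> I \<Longrightarrow> smooth_fun (\<phi> i)) \<Longrightarrow>
    dderiv v (\<lambda>p. \<Sum>i\<in>I. \<phi> i p) p = (\<Sum>i\<in>I. dderiv v (\<phi> i) p)"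
  by (rule dderiv_eqI[OF has_derivative_sum[OF smooth_fun_has_derivative]])

lemma dderiv_linear: "bounded_linear l \<Longrightarrow> dderiv v l p = l v"
  by (rule dderiv_eqI[OF bounded_linear_imp_has_derivative])

lemma dderiv_affine:
  assumes "bounded_linear l" "smooth_fun \<phi>"
  shows "dderiv v (\<lambda>p. \<phi> (c + l p)) p = frechet_derivative \<phi> (at (c + l p)) (l v)"
proof -
  have "((\<lambda>p. c + l p) has_derivative l) (at p)"
    using has_derivative_add[OF has_derivative_const bounded_linear_imp_has_derivative[OF assms(1)]] by simp
  from diff_chain_at[OF this smooth_fun_has_derivative[OF assms(2)]]
  have "((\<lambda>p. \<phi> (c + l p)) has_derivative (\<lambda>v. frechet_derivative \<phi> (at (c + l p)) (l v))) (at p)"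
    by (simp add: o_def)
  then show ?thesis by (rule dderiv_eqI)
qed

lemma smooth_fun_has_real_derivative_along:
  assumes "smooth_fun \<phi>"
  shows "((\<lambda>s. \<phi> (p + s *\<^sub>R v)) has_real_derivative dderiv v \<phi> (p + s *\<^sub>R v)) (at s)"
proof -
  have "((\<lambda>s. p + s *\<^sub>R v) has_derivative (\<lambda>s. s *\<^sub>R v)) (at s)"
    by (auto intro!: derivative_eq_intros)
  from diff_chain_at[OF this smooth_fun_has_derivative[OF assms]]
  have "((\<lambda>s. \<phi> (p + s *\<^sub>R v)) has_derivative (\<lambda>h. frechet_derivative \<phi> (at (p + s *\<^sub>R v)) (h *\<^sub>R v))) (at s)"
    by (simp add: o_def)
  moreover have "linear (frechet_derivative \<phi> (at q))" for q
    by (rule linear_frechet_derivative[OF smooth_fun_differentiable[OF assms]])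
  ultimately show ?thesis
    by (simp add: has_field_derivative_def linear_scale mult_commute_abs)
qed

text \<open>Mean value theorem twice: along \<open>a\<close> for the increment in direction
  \<open>b\<close>, then along \<open>b\<close> for the derivative so obtained.\<close>

lemma second_difference_mean_value:
  assumes "smooth_fun \<phi>" "h > 0"
  obtains q where "norm (q - p) \<le> h * (norm a + norm b)"
    "\<phi> (p + h *\<^sub>R a + h *\<^sub>R b) - \<phi> (p + h *\<^sub>R a) - \<phi> (p + h *\<^sub>R b) + \<phi> p
      = h * h * dderiv b (dderiv a \<phi>) q"
proof -
  define F where "F = (\<lambda>s. \<phi> ((p + h *\<^sub>R b) + s *\<^sub>R a) - \<phi> (p + s *\<^sub>R a))"
  have "(F has_real_derivative dderiv a \<phi> ((p + h *\<^sub>R b) + s *\<^sub>R a) - dderiv a \<phi> (p + s *\<^sub>R a)) (at s)" for s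
    unfolding F_def
    by (intro DERIV_diff smooth_fun_has_real_derivative_along assms)
  from MVT2[OF assms(2), of F, OF this] obtain s where s: "0 < s" "s < h"
    "F h - F 0 = h * (dderiv a \<phi> ((p + h *\<^sub>R b) + s *\<^sub>R a) - dderiv a \<phi> (p + s *\<^sub>R a))" by auto
  have "((\<lambda>t. dderiv a \<phi> ((p + s *\<^sub>R a) + t *\<^sub>R b)) has_real_derivative
      dderiv b (dderiv a \<phi>) ((p + s *\<^sub>R a) + t *\<^sub>R b)) (at t)" for t
    by (rule smooth_fun_has_real_derivative_along[OF smooth_fun_dderiv[OF assms(1)]])
  from MVT2[OF assms(2), of "\<lambda>t. dderiv a \<phi> ((p + s *\<^sub>R a) + t *\<^sub>R b)", OF this]
  obtain t where t: "0 < t" "t < h"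
    "dderiv a \<phi> ((p + s *\<^sub>R a) + h *\<^sub>R b) - dderiv a \<phi> (p + s *\<^sub>R a)
      = h * dderiv b (dderiv a \<phi>) ((p + s *\<^sub>R a) + t *\<^sub>R b)" by auto
  show ?thesis
  proof
    have "norm ((p + s *\<^sub>R a) + t *\<^sub>R b - p) \<le> s * norm a + t * norm b"
      using s t norm_triangle_ineq[of "s *\<^sub>R a" "t *\<^sub>R b"] by (simp add: algebra_simps)
    also have "\<dots> \<le> h * (norm a + norm b)"
      using s t by (simp add: distrib_left add_mono mult_right_mono)
    finally show "norm ((p + s *\<^sub>R a) + t *\<^sub>R b - p) \<le> h * (norm a + norm b)" .
    have "\<phi> (p + h *\<^sub>R a + h *\<^sub>R b) - \<phi> (p + h *\<^sub>R a) - \<phi> (p + h *\<^sub>R b) + \<phi> p = F h - F 0"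
      by (simp add: F_def algebra_simps)
    also have "\<dots> = h * h * dderiv b (dderiv a \<phi>) ((p + s *\<^sub>R a) + t *\<^sub>R b)"
      using s(3) t(3) by (simp add: algebra_simps)
    finally show "\<phi> (p + h *\<^sub>R a + h *\<^sub>R b) - \<phi> (p + h *\<^sub>R a) - \<phi> (p + h *\<^sub>R b) + \<phi> p
      = h * h * dderiv b (dderiv a \<phi>) ((p + s *\<^sub>R a) + t *\<^sub>R b)" .
  qed
qed

text \<open>Schwarz's theorem. The second difference is symmetric in \<open>a\<close> and
  \<open>b\<close>, so the two mixed derivatives share a value at points arbitrarily close to p, and
  continuity forbids a gap at p itself.\<close>

lemma dderiv_commute:
  assumes "smooth_fun \<phi>"
  shows "dderiv a (dderiv b \<phi>) p = dderiv b (dderiv a \<phi>) p"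
proof (rule ccontr)
  let ?A = "dderiv a (dderiv b \<phi>)" and ?B = "dderiv b (dderiv a \<phi>)"
  assume "?A p \<noteq> ?B p"
  then have e: "\<bar>?A p - ?B p\<bar> / 2 > 0" by simp
  have cont: "\<exists>d>0. \<forall>q. dist q p < d \<longrightarrow> \<bar>\<psi> q - \<psi> p\<bar> < \<bar>?A p - ?B p\<bar> / 2"
    if "smooth_fun \<psi>" for \<psi> :: "'a \<Rightarrow> real"
  proof -
    have "isCont \<psi> p"
      using smooth_fun_continuous[OF that] by (simp add: continuous_on_eq_continuous_at)
    then show ?thesis unfolding continuous_at_eps_delta dist_real_def using e by blast
  qed
  obtain d1 where d1: "d1 > 0" "\<And>q. dist q p < d1 \<Longrightarrow> \<bar>?A q - ?A p\<bar> < \<bar>?A p - ?B p\<bar> / 2"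
    using cont[OF smooth_fun_dderiv[OF smooth_fun_dderiv[OF assms]]] by blast
  obtain d2 where d2: "d2 > 0" "\<And>q. dist q p < d2 \<Longrightarrow> \<bar>?B q - ?B p\<bar> < \<bar>?A p - ?B p\<bar> / 2"
    using cont[OF smooth_fun_dderiv[OF smooth_fun_dderiv[OF assms]]] by blast
  \<comment> \<open>The summand 1 keeps \<open>m\<close> positive when \<open>a\<close> and
    \<open>b\<close> both vanish; \<open>h\<close> then puts both mean value points within
    \<open>min d1 d2\<close> of p.\<close>
  define m where "m = norm a + norm b + 1"
  have m: "m > 0" by (simp add: m_def add_nonneg_pos)
  define h where "h = min d1 d2 / (2 * m)"
  have h: "h > 0" using d1(1) d2(1) m by (simp add: h_def)
  have "h * (norm a + norm b) < min d1 d2"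
  proof -
    have "h * (norm a + norm b) \<le> h * m" using h by (simp add: m_def)
    also have "\<dots> = min d1 d2 / 2" using m by (simp add: h_def)
    also have "\<dots> < min d1 d2" using d1(1) d2(1) by (simp add: min_def)
    finally show ?thesis .
  qed
  then have hd: "h * (norm a + norm b) < d1" "h * (norm b + norm a) < d2" by (auto simp: add.commute)
  obtain q1 where q1: "norm (q1 - p) \<le> h * (norm b + norm a)"
    "\<phi> (p + h *\<^sub>R b + h *\<^sub>R a) - \<phi> (p + h *\<^sub>R b) - \<phi> (p + h *\<^sub>R a) + \<phi> p = h * h * ?A q1"
    using second_difference_mean_value[OF assms h, of p b a] by blast
  obtain q2 where q2: "norm (q2 - p) \<le> h * (norm a + norm b)"
    "\<phi> (p + h *\<^sub>R a + h *\<^sub>R b) - \<phi> (p + h *\<^sub>R a) - \<phi> (p + h *\<^sub>R b) + \<phi> p = h * h * ?B q2"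
    using second_difference_mean_value[OF assms h, of p a b] by blast
  have "p + h *\<^sub>R b + h *\<^sub>R a = p + h *\<^sub>R a + h *\<^sub>R b" by simp
  from arg_cong[OF this, of \<phi>] have "h * h * ?A q1 = h * h * ?B q2" using q1(2) q2(2) by linarith
  then have eq: "?A q1 = ?B q2" using h by simp
  have "dist q1 p < d1" "dist q2 p < d2"
    using q1(1) q2(1) hd by (auto simp: dist_norm add.commute)
  from d1(2)[OF this(1)] d2(2)[OF this(2)]
  show False unfolding eq by argo
qed

section \<open>Test functions\<close>

lemma test_fun_iff: "test_fun \<phi> \<longleftrightarrow> smooth_fun \<phi> \<and> (\<exists>R. \<forall>p. \<phi> p \<noteq> 0 \<longrightarrow> norm p \<le> R)"
  by (auto simp: test_fun_def compact_closure bounded_iff)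

lemma test_fun_smooth: "test_fun \<phi> \<Longrightarrow> smooth_fun \<phi>"
  by (simp add: test_fun_def)

lemma test_fun_zero [simp]: "test_fun (\<lambda>p. 0)"
  by (simp add: test_fun_iff)

lemma test_fun_mult_smooth:
  "smooth_fun \<psi> \<Longrightarrow> test_fun \<phi> \<Longrightarrow> test_fun (\<lambda>p. \<psi> p * \<phi> p)"
  by (auto simp: test_fun_iff intro: smooth_fun_mult)

lemma test_fun_add: "test_fun \<phi> \<Longrightarrow> test_fun \<psi> \<Longrightarrow> test_fun (\<lambda>p. \<phi> p + \<psi> p)"
  unfolding test_fun_iff
proof (elim conjE exE, intro conjI)
  fix R R' assume "\<forall>p. \<phi> p \<noteq> 0 \<longrightarrow> norm p \<le> R" "\<forall>p. \<psi> p \<noteq> 0 \<longrightarrow> norm p \<le> R'"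
  then have "\<phi> p + \<psi> p \<noteq> 0 \<longrightarrow> norm p \<le> max R R'" for p
    by (metis add_0 le_max_iff_disj)
  then show "\<exists>R. \<forall>p. \<phi> p + \<psi> p \<noteq> 0 \<longrightarrow> norm p \<le> R" by blast
qed (rule smooth_fun_add)

lemma test_fun_sum: "(\<And>i. i \<in> I \<Longrightarrow> test_fun (\<phi> i)) \<Longrightarrow> test_fun (\<lambda>p. \<Sum>i\<in>I. \<phi> i p)"
  by (induction I rule: infinite_finite_induct) (auto intro: test_fun_add)

lemma test_fun_dderiv:
  assumes "test_fun \<phi>" shows "test_fun (dderiv v \<phi>)"
proof -
  obtain R where R: "\<And>p. \<phi> p \<noteq> 0 \<Longrightarrow> norm p \<le> R" using assms test_fun_iff by blast
  have "norm p \<le> R" if "dderiv v \<phi> p \<noteq> 0" for p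
  proof (rule ccontr)
    assume "\<not> norm p \<le> R"
    then have "p \<in> - cball 0 R" by simp
    moreover have "open (- cball (0::'a) R)" by (simp add: open_Compl)
    moreover have "0 = \<phi> q" if "q \<in> - cball 0 R" for q using R that by force
    ultimately have "(\<phi> has_derivative (\<lambda>v. 0)) (at p)"
      using has_derivative_transform_within_open[of "\<lambda>_. 0" "\<lambda>_. 0" p UNIV "- cball 0 R" \<phi>] by simp
    then have "dderiv v \<phi> p = 0" by (rule dderiv_eqI)
    then show False using that by simp
  qed
  then show ?thesis using assms smooth_fun_dderiv unfolding test_fun_iff by blast
qed

lemma test_fun_bounded:
  assumes "test_fun \<phi>" obtains M where "M > 0" "\<And>p. \<bar>\<phi> p\<bar> \<le> M"
proof -
  have "compact (closure {p. \<phi> p \<noteq> 0})" "continuous_on (closure {p. \<phi> p \<noteq> 0}) \<phi>"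
    using assms continuous_on_subset[OF smooth_fun_continuous, of \<phi>] unfolding test_fun_def by auto
  then have "bounded (\<phi> ` closure {p. \<phi> p \<noteq> 0})"
    using compact_continuous_image compact_imp_bounded by blast
  then obtain M where M: "M > 0" "\<And>p. p \<in> closure {p. \<phi> p \<noteq> 0} \<Longrightarrow> \<bar>\<phi> p\<bar> \<le> M"
    unfolding bounded_pos by auto
  have "\<bar>\<phi> p\<bar> \<le> M" for p
    using M closure_subset[of "{p. \<phi> p \<noteq> 0}"] by (cases "\<phi> p = 0") auto
  then show ?thesis using M that by blast
qed

lemma test_fun_borel [measurable (raw)]: "test_fun \<phi> \<Longrightarrow> \<phi> \<in> borel_measurable borel"
  using smooth_fun_continuous test_fun_smooth borel_measurable_continuous_onI by blast

lemma test_fun_integrable: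
  assumes "test_fun \<phi>" shows "integrable lborel \<phi>"
proof -
  obtain M where M: "M > 0" "\<And>p. \<bar>\<phi> p\<bar> \<le> M" using test_fun_bounded[OF assms] by metis
  obtain R where R: "\<And>p. \<phi> p \<noteq> 0 \<Longrightarrow> norm p \<le> R" using assms test_fun_iff by blast
  show ?thesis
  proof (rule Bochner_Integration.integrable_bound)
    show "integrable lborel (\<lambda>p. M * indicator (cball 0 R) p)"
      using emeasure_lborel_cball_finite by (intro integrable_mult_right integrable_real_indicator) auto
    have "norm (\<phi> p) \<le> norm (M * indicator (cball 0 R) p)" for p
      using M R[of p] by (cases "\<phi> p = 0") auto
    then show "AE p in lborel. norm (\<phi> p) \<le> norm (M * indicator (cball 0 R) p)"
      by simp
  qed (use test_fun_borel[OF assms] in simp)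
qed

subsection \<open>A smooth step and telescoping of tensor products\<close>

text \<open>The powers of 1/x make the family closed under differentiation, up to linear
  combinations, so one induction covers the flat function exp(-1/x) together with all its
  derivatives.\<close>

definition exp_recip :: "nat \<Rightarrow> real \<Rightarrow> real" where
  "exp_recip n x = (if x \<le> 0 then 0 else exp (- inverse x) * inverse x ^ n)"

lemma exp_recip_tendsto_0: "(exp_recip n \<longlongrightarrow> 0) (at 0)"
proof (rule filterlim_split_at)
  have "\<forall>\<^sub>F x in at_left (0::real). exp_recip n x = 0"
    by (auto simp: eventually_at_left_field exp_recip_def intro: exI[of _ "-1"])
  then show "(exp_recip n \<longlongrightarrow> 0) (at_left 0)" by (rule tendsto_eventually)
  have "((\<lambda>x. inverse x ^ n / exp (inverse x)) \<longlongrightarrow> (0::real)) (at_right 0)"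
    by (rule filterlim_compose[OF tendsto_power_div_exp_0 filterlim_inverse_at_top_right])
  moreover have "\<forall>\<^sub>F x in at_right (0::real). inverse x ^ n / exp (inverse x) = exp_recip n x"
    by (auto simp: eventually_at_right_field exp_recip_def exp_minus field_simps intro: exI[of _ 1])
  ultimately show "(exp_recip n \<longlongrightarrow> 0) (at_right 0)"
    by (rule Lim_transform_eventually)
qed

lemma exp_recip_has_real_derivative:
  "(exp_recip n has_real_derivative - real n * exp_recip (Suc n) x + exp_recip (n + 2) x) (at x)"
proof -
  consider "x < 0" | "x = 0" | "x > 0" by linarith
  then show ?thesis
  proof cases
    case 1
    have "((\<lambda>x. 0) has_real_derivative 0) (at x)" by simp
    then have "(exp_recip n has_real_derivative 0) (at x)"
      by (rule has_field_derivative_transform_within_open[where S = "{..<0}"])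
        (use 1 in \<open>auto simp: exp_recip_def\<close>)
    then show ?thesis using 1 by (simp add: exp_recip_def)
  next
    case 2
    \<comment> \<open>Division by \<open>h\<close> only raises the exponent, so the difference
      quotient at 0 belongs to the family and tends to 0.\<close>
    have "(\<lambda>h. exp_recip n h / h) = exp_recip (Suc n)"
      by (auto simp: exp_recip_def field_simps fun_eq_iff)
    then have "(exp_recip n has_real_derivative 0) (at 0)"
      using exp_recip_tendsto_0[of "Suc n"] by (simp add: DERIV_def exp_recip_def[of n 0])
    then show ?thesis using 2 by (simp add: exp_recip_def)
  next
    case 3
    have "((\<lambda>x. exp (- inverse x) * inverse x ^ n) has_real_derivative
       - real n * exp_recip (Suc n) x + exp_recip (n + 2) x) (at x)"
      using 3 by (cases n) (auto intro!: derivative_eq_intros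
          simp: exp_recip_def power2_eq_square field_simps power_Suc, metis One_nat_def power_eq_if)
    then show ?thesis
      by (rule has_field_derivative_transform_within_open[where S = "{0<..}"])
        (use 3 in \<open>auto simp: exp_recip_def\<close>)
  qed
qed

lemma exp_recip_Ck: "exp_recip n \<in> Ck k"
proof (induction k arbitrary: n)
  case 0
  have "isCont (exp_recip n) x" for x
    using exp_recip_has_real_derivative DERIV_isCont by blast
  then show ?case by (simp add: continuous_on_eq_continuous_at)
next
  case (Suc k)
  have "(\<lambda>x. (- real n * exp_recip (Suc n) x + exp_recip (n + 2) x) * 1) \<in> Ck k"
    by (intro Ck_mult Ck_add Ck_const Suc.IH)
  then show ?case
    using exp_recip_has_real_derivative[of n]
    by (intro Ck_SucI[where \<phi>' = "\<lambda>x. (*) (- real n * exp_recip (Suc n) x + exp_recip (n + 2) x)"])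
      (auto simp: has_field_derivative_def)
qed

text \<open>\<open>\<beta>\<close> is a multiple of exp(-1/x) exp(-1/(1-x)) and
  \<open>\<Theta>\<close> a primitive. A primitive is constant on either side of the unit interval,
  and positivity of the bump inside makes its total increment positive, which permits normalising it
  to 1. The bump serves as one-dimensional kernel, the step as a potential for differences of
  bumps.\<close>

lemma smooth_step_exists:
  obtains \<Theta> \<beta> :: "real \<Rightarrow> real"
  where "smooth_fun \<Theta>" "smooth_fun \<beta>" "\<And>x. (\<Theta> has_real_derivative \<beta> x) (at x)"
    "\<And>x. x \<le> 0 \<Longrightarrow> \<Theta> x = 0" "\<And>x. x \<ge> 1 \<Longrightarrow> \<Theta> x = 1"
    "\<And>x. x \<notin> {0..1} \<Longrightarrow> \<beta> x = 0"
proof -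
  define \<beta> where "\<beta> x = exp_recip 0 x * exp_recip 0 (1 - x)" for x
  have sm0: "smooth_fun (exp_recip 0)" by (simp add: smooth_fun_def exp_recip_Ck del: Ck.simps)
  have "smooth_fun (\<lambda>x. exp_recip 0 (1 + (- x)))"
    by (rule smooth_fun_affine[OF _ sm0]) (rule bounded_linear_minus[OF bounded_linear_ident])
  then have sm: "smooth_fun \<beta>"
    unfolding \<beta>_def using smooth_fun_mult[OF sm0] by simp
  have "\<exists>F. \<forall>x. -\<infinity> < ereal x \<longrightarrow> ereal x < \<infinity> \<longrightarrow> (F has_vector_derivative \<beta> x) (at x)"
    by (rule einterval_antiderivative)
      (use smooth_fun_continuous[OF sm] in \<open>auto simp: continuous_on_eq_continuous_at\<close>)
  then obtain F where "\<And>x. (F has_vector_derivative \<beta> x) (at x)" by auto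
  then have F: "(F has_real_derivative \<beta> x) (at x)" for x
    by (simp add: has_real_derivative_iff_has_vector_derivative)
  have b0: "\<beta> x = 0" if "x \<le> 0 \<or> x \<ge> 1" for x
    using that by (auto simp: \<beta>_def exp_recip_def)
  have bpos: "\<beta> x > 0" if "0 < x" "x < 1" for x
    using that by (auto simp: \<beta>_def exp_recip_def)
  have cont: "continuous_on S F" for S
    by (rule DERIV_continuous_on[OF has_field_derivative_at_within[OF F]])
  have flat: "F y = F x" if "x < y" "y \<le> 0 \<or> x \<ge> 1" for x y
  proof (rule DERIV_isconst2[OF that(1) cont])
    show "(F has_real_derivative 0) (at z)" if "x < z" "z < y" for z
      using F[of z] b0[of z] that \<open>y \<le> 0 \<or> x \<ge> 1\<close> by auto
  qed (use that in auto)
  have left: "F x = F 0" if "x \<le> 0" for x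
    using flat[of x 0] that by (cases "x = 0") auto
  have right: "F x = F 1" if "x \<ge> 1" for x
    using flat[of 1 x] that by (cases "x = 1") auto
  have "F 0 < F 1"
    by (rule DERIV_pos_imp_increasing_open[OF zero_less_one _ cont]) (use F bpos in blast)
  define \<Theta> where "\<Theta> x = (F x - F 0) * inverse (F 1 - F 0)" for x
  have D: "(\<Theta> has_real_derivative \<beta> x * inverse (F 1 - F 0)) (at x)" for x
    unfolding \<Theta>_def using DERIV_cmult_right[OF DERIV_diff[OF F DERIV_const]] by simp
  have sm': "smooth_fun (\<lambda>x. \<beta> x * inverse (F 1 - F 0))"
    by (intro smooth_fun_mult sm smooth_fun_const)
  show ?thesis
  proof (rule that[OF _ sm' D])
    show "smooth_fun \<Theta>"
    proof (rule smooth_funI)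
      show "(\<Theta> has_derivative (*) (\<beta> x * inverse (F 1 - F 0))) (at x)" for x
        using D[of x] by (simp add: has_field_derivative_def)
      show "smooth_fun (\<lambda>x. \<beta> x * inverse (F 1 - F 0) * b)" for b
        by (intro smooth_fun_mult sm smooth_fun_const)
    qed
    show "\<Theta> x = 0" if "x \<le> 0" for x using left[OF that] by (simp add: \<Theta>_def)
    show "\<Theta> x = 1" if "x \<ge> 1" for x using right[OF that] \<open>F 0 < F 1\<close> by (simp add: \<Theta>_def)
    show "\<beta> x * inverse (F 1 - F 0) = 0" if "x \<notin> {0..1}" for x
      using b0[of x] that by (cases "x \<le> 0") auto
  qed
qed

lemma test_fun_tensor:
  fixes u :: "'a::euclidean_space \<Rightarrow> real \<Rightarrow> real"
  assumes "\<And>b. b \<in> Basis \<Longrightarrow> smooth_fun (u b)"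
    and "\<And>b x. b \<in> Basis \<Longrightarrow> x \<notin> {0..1} \<Longrightarrow> u b x = 0"
  shows "test_fun (\<lambda>q. \<Prod>b\<in>Basis. u b (q \<bullet> b))"
  unfolding test_fun_iff
proof (intro conjI exI allI impI)
  have "smooth_fun (\<lambda>q. u b (q \<bullet> b))" if "b \<in> Basis" for b
    using smooth_fun_affine[OF bounded_linear_inner_left assms(1)[OF that], of 0 b] by simp
  then show "smooth_fun (\<lambda>q. \<Prod>b\<in>Basis. u b (q \<bullet> b))" by (rule smooth_fun_prod)
  fix q :: 'a assume "(\<Prod>b\<in>Basis. u b (q \<bullet> b)) \<noteq> 0"
  then have "u b (q \<bullet> b) \<noteq> 0" if "b \<in> Basis" for b using that by simp
  then have *: "\<bar>q \<bullet> b\<bar> \<le> 1" if "b \<in> Basis" for b using that assms(2)[of b "q \<bullet> b"] by force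
  have "norm q \<le> (\<Sum>b\<in>Basis. \<bar>q \<bullet> b\<bar>)" by (rule norm_le_l1)
  also have "\<dots> \<le> (\<Sum>b\<in>(Basis::'a set). 1)" by (intro sum_mono *)
  finally show "norm q \<le> real DIM('a)" by simp
qed

text \<open>Exchanging the factor \<open>w b\<close> for \<open>u b\<close> in one coordinate
  changes the product by a b-derivative: put \<open>\<gamma> b\<close>, a primitive of the
  difference, in that slot. Summing over the coordinates reaches the full difference, so a property
  closed under sums need only be checked on derivatives of test functions.\<close>

lemma tensor_difference_induct:
  fixes u w :: "'a::euclidean_space \<Rightarrow> real \<Rightarrow> real" and P :: "('a \<Rightarrow> real) \<Rightarrow> bool"
  assumes smooth: "\<And>b. b \<in> Basis \<Longrightarrow> smooth_fun (u b) \<and> smooth_fun (w b) \<and> smooth_fun (\<gamma> b)"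
    and supp: "\<And>b x. b \<in> Basis \<Longrightarrow> x \<notin> {0..1} \<Longrightarrow> u b x = 0 \<and> w b x = 0 \<and> \<gamma> b x = 0"
    and deriv: "\<And>b x. b \<in> Basis \<Longrightarrow> (\<gamma> b has_real_derivative u b x - w b x) (at x)"
    and zero: "P (\<lambda>q. 0)" and add: "\<And>g h. P g \<Longrightarrow> P h \<Longrightarrow> P (\<lambda>q. g q + h q)"
    and dderiv: "\<And>b H. b \<in> Basis \<Longrightarrow> test_fun H \<Longrightarrow> P (dderiv b H)"
  shows "P (\<lambda>q. (\<Prod>b\<in>Basis. u b (q \<bullet> b)) - (\<Prod>b\<in>Basis. w b (q \<bullet> b)))"
proof -
  \<comment> \<open>Mixed products: coordinates in \<open>B\<close> already carry \<open>u\<close>,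
    the others still \<open>w\<close>.\<close>
  define M where "M B = (\<lambda>q. \<Prod>b\<in>Basis. (if b \<in> B then u b else w b) (q \<bullet> b))" for B
  have "P (\<lambda>q. M B q - M {} q)" if "finite B" "B \<subseteq> Basis" for B
    using that
  proof (induction B rule: finite_induct)
    case empty
    then show ?case by (simp add: zero)
  next
    case (insert b B)
    then have b: "b \<in> Basis" by simp
    define R where "R q = (\<Prod>c\<in>Basis - {b}. (if c \<in> B then u c else w c) (q \<bullet> c))" for q
    define H where "H q = (\<Prod>c\<in>Basis. (if c = b then \<gamma> b else if c \<in> B then u c else w c) (q \<bullet> c))" for q
    have H: "test_fun H"
      unfolding H_def using smooth supp by (intro test_fun_tensor) auto
    have split: "(\<Prod>c\<in>Basis. f c) = f b * (\<Prod>c\<in>Basis - {b}. f c)" for f :: "'a \<Rightarrow> real"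
      using b by (simp add: prod.remove)
    have HR: "H q = \<gamma> b (q \<bullet> b) * R q" for q
      unfolding H_def R_def split by (auto intro!: prod.cong arg_cong2[where f = "(*)"])
    \<comment> \<open>\<open>R\<close> omits coordinate b, so along b only the factor
      \<open>\<gamma> b\<close> varies.\<close>
    have Rb: "R (q + s *\<^sub>R b) = R q" for q s
      unfolding R_def using b by (intro prod.cong) (auto simp: inner_add_left inner_Basis)
    have "dderiv b H q = M (insert b B) q - M B q" for q
    proof -
      have "((\<lambda>s. H (q + s *\<^sub>R b)) has_real_derivative dderiv b H (q + 0 *\<^sub>R b)) (at 0)"
        by (rule smooth_fun_has_real_derivative_along[OF test_fun_smooth[OF H]])
      moreover have "(\<lambda>s. H (q + s *\<^sub>R b)) = (\<lambda>s. \<gamma> b (q \<bullet> b + s) * R q)"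
        unfolding HR Rb using b by (simp add: inner_add_left)
      moreover have "((\<lambda>s. \<gamma> b (q \<bullet> b + s) * R q) has_real_derivative
          (u b (q \<bullet> b) - w b (q \<bullet> b)) * R q) (at 0)"
        using deriv[OF b, of "q \<bullet> b"] DERIV_at_within_shift[of "\<gamma> b" _ "q \<bullet> b" 0 UNIV]
        by (intro DERIV_cmult_right) simp
      ultimately have "dderiv b H q = (u b (q \<bullet> b) - w b (q \<bullet> b)) * R q"
        using DERIV_unique by fastforce
      moreover have "M (insert b B) q = u b (q \<bullet> b) * R q" "M B q = w b (q \<bullet> b) * R q"
        using insert unfolding M_def R_def split
        by (auto intro!: prod.cong arg_cong2[where f = "(*)"])
      ultimately show ?thesis by (simp add: left_diff_distrib)
    qed
    then have "dderiv b H = (\<lambda>q. M (insert b B) q - M B q)" by blast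
    with dderiv[OF b H] have "P (\<lambda>q. M (insert b B) q - M B q)" by simp
    from add[OF this] insert show ?case by fastforce
  qed
  from this[of Basis] show ?thesis by (simp add: M_def cong: prod.cong)
qed

subsection \<open>Kinetic divergences\<close>

abbreviation e_t :: "'n::finite phase" where "e_t \<equiv> (1, 0, 0)"
abbreviation e_x :: "'n::finite \<Rightarrow> 'n phase" where "e_x i \<equiv> (0, axis i 1, 0)"
abbreviation e_v :: "'n::finite \<Rightarrow> 'n phase" where "e_v i \<equiv> (0, 0, axis i 1)"

definition transport :: "('n::finite phase \<Rightarrow> real) \<Rightarrow> 'n phase \<Rightarrow> real" where
  "transport A q = frechet_derivative A (at q) (1, snd (snd q), 0)"

lemma vec_axis_expansion: "(w :: real ^ 'n) = (\<Sum>j\<in>UNIV. (w $ j) *\<^sub>R axis j 1)"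
  by (simp add: vec_eq_iff axis_def if_distrib cong: if_cong)

lemma transport_expansion:
  assumes "smooth_fun A"
  shows "transport A q = dderiv e_t A q + (\<Sum>j\<in>UNIV. (snd (snd q) $ j) * dderiv (e_x j) A q)"
proof -
  interpret linear "frechet_derivative A (at q)"
    by (rule linear_frechet_derivative[OF smooth_fun_differentiable[OF assms]])
  have "(1, snd (snd q), 0) = e_t + (\<Sum>j\<in>UNIV. (snd (snd q) $ j) *\<^sub>R e_x j)"
    using vec_axis_expansion[of "snd (snd q)"]
    by (simp add: prod_eq_iff fst_sum snd_sum)
  then show ?thesis by (simp only: transport_def add sum scale real_scaleR_def)
qed

lemma bounded_linear_velocity: "bounded_linear (\<lambda>q :: 'n::finite phase. snd (snd q) $ j)"
  by (intro bounded_linear_compose[OF bounded_linear_vec_nth]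
      bounded_linear_compose[OF bounded_linear_snd] bounded_linear_snd)

lemma smooth_fun_velocity: "smooth_fun (\<lambda>q :: 'n::finite phase. snd (snd q) $ j)"
  by (rule smooth_fun_linear[OF bounded_linear_velocity])

lemma test_fun_transport:
  assumes "test_fun A" shows "test_fun (transport A)"
proof -
  have "test_fun (\<lambda>q. dderiv e_t A q + (\<Sum>j\<in>UNIV. (snd (snd q) $ j) * dderiv (e_x j) A q))"
    by (intro test_fun_add test_fun_sum test_fun_mult_smooth smooth_fun_velocity test_fun_dderiv assms)
  moreover have "transport A = (\<lambda>q. dderiv e_t A q + (\<Sum>j\<in>UNIV. (snd (snd q) $ j) * dderiv (e_x j) A q))"
    using transport_expansion[OF test_fun_smooth[OF assms]] by blast
  ultimately show ?thesis by (rule ssubst[rotated])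
qed

lemma transport_add:
  "smooth_fun A \<Longrightarrow> smooth_fun B \<Longrightarrow> transport (\<lambda>q. A q + B q) q = transport A q + transport B q"
  unfolding transport_def by (rule dderiv_add)

lemma transport_cmult:
  "smooth_fun A \<Longrightarrow> transport (\<lambda>q. c * A q) q = c * transport A q"
  unfolding transport_def by (rule dderiv_cmult)

lemma transport_zero: "transport (\<lambda>q. 0) q = 0"
  by (simp add: transport_def)

text \<open>The class on which both weak equations act: paired with f, the transport of
  \<open>A\<close> is traded for S and the v-divergence of \<open>B\<close> for the weak gradient.
  Both potentials are test functions because they are what the equations are tested with.\<close>

definition kinetic_divergence :: "('n::finite phase \<Rightarrow> real) \<Rightarrow> bool" where
  "kinetic_divergence h \<longleftrightarrow> (\<exists>A B. test_fun A \<and> (\<forall>i. test_fun (B i)) \<and>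
     (\<forall>q. h q = transport A q + (\<Sum>i\<in>UNIV. dderiv (e_v i) (B i) q)))"

lemma kinetic_divergenceI:
  assumes "test_fun A" "\<And>i. test_fun (B i)"
    "\<And>q. h q = transport A q + (\<Sum>i\<in>UNIV. dderiv (e_v i) (B i) q)"
  shows "kinetic_divergence h"
  unfolding kinetic_divergence_def using assms by blast

lemma kinetic_divergence_zero: "kinetic_divergence (\<lambda>q. 0)"
  by (rule kinetic_divergenceI[where A = "\<lambda>q. 0" and B = "\<lambda>i q. 0"]) (simp_all add: transport_zero)

lemma kinetic_divergence_add:
  assumes "kinetic_divergence g" "kinetic_divergence h"
  shows "kinetic_divergence (\<lambda>q. g q + h q)"
proof -
  obtain A B where g: "test_fun A" "\<And>i. test_fun (B i)"
    "\<And>q. g q = transport A q + (\<Sum>i\<in>UNIV. dderiv (e_v i) (B i) q)"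
    using assms(1) unfolding kinetic_divergence_def by blast
  obtain A' B' where h: "test_fun A'" "\<And>i. test_fun (B' i)"
    "\<And>q. h q = transport A' q + (\<Sum>i\<in>UNIV. dderiv (e_v i) (B' i) q)"
    using assms(2) unfolding kinetic_divergence_def by blast
  note sm = g(1,2)[THEN test_fun_smooth] h(1,2)[THEN test_fun_smooth]
  show ?thesis
  proof (rule kinetic_divergenceI)
    show "test_fun (\<lambda>q. A q + A' q)" "test_fun (\<lambda>q. B i q + B' i q)" for i
      by (rule test_fun_add[OF g(1) h(1)], rule test_fun_add[OF g(2) h(2)])
    show "g q + h q = transport (\<lambda>q. A q + A' q) q + (\<Sum>i\<in>UNIV. dderiv (e_v i) (\<lambda>q. B i q + B' i q) q)" for q
      unfolding g(3) h(3) transport_add[OF sm(1,3)] dderiv_add[OF sm(2,4)] sum.distrib by simp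
  qed
qed

lemma kinetic_divergence_cmult:
  assumes "kinetic_divergence h" shows "kinetic_divergence (\<lambda>q. c * h q)"
proof -
  obtain A B where h: "test_fun A" "\<And>i. test_fun (B i)"
    "\<And>q. h q = transport A q + (\<Sum>i\<in>UNIV. dderiv (e_v i) (B i) q)"
    using assms(1) unfolding kinetic_divergence_def by blast
  note sm = h(1,2)[THEN test_fun_smooth]
  show ?thesis
  proof (rule kinetic_divergenceI)
    show "test_fun (\<lambda>q. c * A q)" "test_fun (\<lambda>q. c * B i q)" for i
      by (rule test_fun_mult_smooth[OF smooth_fun_const h(1)],
          rule test_fun_mult_smooth[OF smooth_fun_const h(2)])
    show "c * h q = transport (\<lambda>q. c * A q) q + (\<Sum>i\<in>UNIV. dderiv (e_v i) (\<lambda>q. c * B i q) q)" for q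
      unfolding h(3) transport_cmult[OF sm(1)] dderiv_cmult[OF sm(2)]
      by (simp add: distrib_left sum_distrib_left)
  qed
qed

lemma kinetic_divergence_sum:
  "(\<And>i. i \<in> I \<Longrightarrow> kinetic_divergence (h i)) \<Longrightarrow> kinetic_divergence (\<lambda>q. \<Sum>i\<in>I. h i q)"
  by (induction I rule: infinite_finite_induct)
    (auto intro: kinetic_divergence_zero kinetic_divergence_add)

lemma kinetic_divergence_transport: "test_fun H \<Longrightarrow> kinetic_divergence (transport H)"
  by (rule kinetic_divergenceI[where A = H and B = "\<lambda>i q. 0"]) simp_all

lemma kinetic_divergence_dderiv_v:
  assumes "test_fun H" shows "kinetic_divergence (dderiv (e_v i) H)"
proof (rule kinetic_divergenceI[where A = "\<lambda>q. 0" and B = "\<lambda>j q. (if j = i then 1 else 0) * H q"])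
  have "dderiv (e_v j) (\<lambda>q. (if j = i then 1 else 0) * H q) q = (if j = i then dderiv (e_v j) H q else 0)" for j q
    using dderiv_cmult[OF test_fun_smooth[OF assms]] by simp
  then show "dderiv (e_v i) H q = transport (\<lambda>q. 0) q +
      (\<Sum>j\<in>UNIV. dderiv (e_v j) (\<lambda>q. (if j = i then 1 else 0) * H q) q)" for q
    by (simp add: transport_zero)
qed (use assms test_fun_mult_smooth in auto)

text \<open>The commutator identity \<open>\<partial>\<^sub>x = [\<partial>\<^sub>v, \<partial>\<^sub>t + v \<cdot> \<nabla>\<^sub>x]\<close>: differentiating twice in the
  admissible directions reaches \<open>x\<close>.\<close>

lemma dderiv_x_commutator:
  assumes "smooth_fun H"
  shows "dderiv (e_x i) H q = dderiv (e_v i) (transport H) q - transport (dderiv (e_v i) H) q"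
proof -
  let ?w = "\<lambda>j (q :: 'a phase). snd (snd q) $ j"
  have sm: "smooth_fun (dderiv v H)" for v by (rule smooth_fun_dderiv[OF assms])
  have eq: "transport H = (\<lambda>q. dderiv e_t H q + (\<Sum>j\<in>UNIV. ?w j q * dderiv (e_x j) H q))"
    using transport_expansion[OF assms] by blast
  have w: "dderiv (e_v i) (?w j) q = (if i = j then 1 else 0)" for j
    by (simp add: dderiv_linear[OF bounded_linear_velocity] axis_def)
  have "dderiv (e_v i) (transport H) q = dderiv (e_v i) (dderiv e_t H) q +
      (\<Sum>j\<in>UNIV. dderiv (e_v i) (\<lambda>q. ?w j q * dderiv (e_x j) H q) q)"
    unfolding eq using smooth_fun_mult[OF smooth_fun_velocity sm]
    by (simp add: dderiv_add dderiv_sum sm smooth_fun_sum)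
  also have "\<dots> = dderiv (e_v i) (dderiv e_t H) q +
      (\<Sum>j\<in>UNIV. ?w j q * dderiv (e_v i) (dderiv (e_x j) H) q + (if i = j then 1 else 0) * dderiv (e_x j) H q)"
    by (simp only: dderiv_mult[OF smooth_fun_velocity sm] w)
  also have "\<dots> = dderiv e_t (dderiv (e_v i) H) q +
      (\<Sum>j\<in>UNIV. ?w j q * dderiv (e_x j) (dderiv (e_v i) H) q) + dderiv (e_x i) H q"
    by (simp add: dderiv_commute[OF assms, of "e_v i"] sum.distrib if_distrib[of "\<lambda>c. c * _"] cong: if_cong)
  also have "\<dots> = transport (dderiv (e_v i) H) q + dderiv (e_x i) H q"
    using transport_expansion[OF sm] by simp
  finally show ?thesis by simp
qed

lemma kinetic_divergence_dderiv_x: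
  assumes "test_fun H" shows "kinetic_divergence (dderiv (e_x i) H)"
proof -
  have "kinetic_divergence (\<lambda>q. dderiv (e_v i) (transport H) q + (- 1) * transport (dderiv (e_v i) H) q)"
    by (intro kinetic_divergence_add kinetic_divergence_cmult kinetic_divergence_dderiv_v
        kinetic_divergence_transport test_fun_transport test_fun_dderiv assms)
  moreover have "dderiv (e_x i) H = (\<lambda>q. dderiv (e_v i) (transport H) q + (- 1) * transport (dderiv (e_v i) H) q)"
    using dderiv_x_commutator[OF test_fun_smooth[OF assms]] by auto
  ultimately show ?thesis by (rule ssubst[rotated])
qed

text \<open>The velocity coefficients do not depend on x, so the transport term in x is itself an
  x-divergence, of the test functions \<open>?w j q * H q\<close>, and can be subtracted from
  \<open>transport H\<close>.\<close>

lemma kinetic_divergence_dderiv_t: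
  assumes "test_fun H" shows "kinetic_divergence (dderiv e_t H)"
proof -
  let ?w = "\<lambda>j (q :: 'a phase). snd (snd q) $ j"
  have sm: "smooth_fun H" by (rule test_fun_smooth[OF assms])
  have "kinetic_divergence (\<lambda>q. transport H q + (- 1) * (\<Sum>j\<in>UNIV. dderiv (e_x j) (\<lambda>q. ?w j q * H q) q))"
    by (intro kinetic_divergence_add kinetic_divergence_cmult kinetic_divergence_dderiv_x
        kinetic_divergence_transport kinetic_divergence_sum test_fun_mult_smooth smooth_fun_velocity assms)
  moreover have "dderiv e_t H q = transport H q + (- 1) * (\<Sum>j\<in>UNIV. dderiv (e_x j) (\<lambda>q. ?w j q * H q) q)" for q
  proof -
    have "dderiv (e_x j) (?w j) q = 0" for j
      by (simp add: dderiv_linear[OF bounded_linear_velocity])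
    then have "dderiv (e_x j) (\<lambda>q. ?w j q * H q) q = ?w j q * dderiv (e_x j) H q" for j
      by (simp add: dderiv_mult[OF smooth_fun_velocity sm])
    then show ?thesis using transport_expansion[OF sm] by simp
  qed
  then have "dderiv e_t H = (\<lambda>q. transport H q + (- 1) * (\<Sum>j\<in>UNIV. dderiv (e_x j) (\<lambda>q. ?w j q * H q) q))"
    by blast
  ultimately show ?thesis by (rule ssubst[rotated])
qed

section \<open>Homogeneous dilations and the dyadic kernel\<close>

lemma Basis_phase:
  "(Basis :: 'n::finite phase set) = {e_t} \<union> range e_x \<union> range e_v"
  by (auto simp: Basis_prod_def Basis_vec_def image_iff zero_prod_def)

definition dilate :: "real \<Rightarrow> 'n::finite phase \<Rightarrow> 'n phase" where
  "dilate r = (\<lambda>(s, y, w). (r ^ 2 * s, r ^ 3 *\<^sub>R y, r *\<^sub>R w))"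

text \<open>The exponent of the Jacobian of \<open>dilate r\<close>: 2 from time, 3n from position,
  n from velocity.\<close>

definition kdim :: "'n::finite itself \<Rightarrow> nat" where
  "kdim _ = 2 + 4 * CARD('n)"

lemma prod_Basis_phase:
  fixes F :: "'n::finite phase \<Rightarrow> real"
  shows "(\<Prod>b\<in>Basis. F b) = F e_t * ((\<Prod>i\<in>UNIV. F (e_x i)) * (\<Prod>i\<in>UNIV. F (e_v i)))"
proof -
  have 1: "inj (e_x :: 'n \<Rightarrow> _)" "inj (e_v :: 'n \<Rightarrow> _)"
    by (auto simp: inj_on_def axis_eq_axis)
  have "(\<Prod>b\<in>Basis. F b) = (\<Prod>b\<in>{e_t}. F b) * ((\<Prod>b\<in>range e_x. F b) * (\<Prod>b\<in>range e_v. F b))"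
  proof -
    have "range e_x \<inter> range (e_v :: 'n \<Rightarrow> _) = {}" "{e_t} \<inter> (range e_x \<union> range (e_v :: 'n \<Rightarrow> _)) = {}"
      by (auto simp: axis_eq_0_iff)
    then show ?thesis unfolding Basis_phase Un_assoc by (simp only: prod.union_disjoint finite_UnI finite_imageI finite finite.intros)
  qed
  then show ?thesis using 1 by (simp add: prod.reindex)
qed

lemma integral_tensor:
  fixes u :: "'a::euclidean_space \<Rightarrow> real \<Rightarrow> real"
  assumes "\<And>b. b \<in> Basis \<Longrightarrow> integrable lborel (u b)"
  shows "(\<integral>q. (\<Prod>b\<in>Basis. u b (q \<bullet> b)) \<partial>lborel) = (\<Prod>b\<in>Basis. \<integral>x. u b x \<partial>lborel)"
proof -
  interpret product_sigma_finite "\<lambda>_ :: 'a. lborel :: real measure" ..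
  let ?F = "\<lambda>q :: 'a. \<Prod>b\<in>Basis. u b (q \<bullet> b)" and ?g = "\<lambda>f. \<Sum>b\<in>(Basis :: 'a set). f b *\<^sub>R b"
  have [measurable]: "u b \<in> borel_measurable borel" if "b \<in> Basis" for b
    using borel_measurable_integrable[OF assms[OF that]] by simp
  have "integral\<^sup>L lborel ?F = integral\<^sup>L (distr (\<Pi>\<^sub>M b\<in>Basis. lborel) borel ?g) ?F"
    by (simp only: lborel_eq[symmetric])
  also have "\<dots> = (\<integral>f. ?F (?g f) \<partial>(\<Pi>\<^sub>M b\<in>Basis. lborel))"
    by (rule integral_distr) measurable
  also have "\<dots> = (\<integral>f. (\<Prod>b\<in>Basis. u b (f b)) \<partial>(\<Pi>\<^sub>M b\<in>Basis. lborel))"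
    by (simp add: inner_sum_left_Basis cong: prod.cong)
  also have "\<dots> = (\<Prod>b\<in>Basis. \<integral>x. u b x \<partial>lborel)"
    by (rule product_integral_prod) (use assms in auto)
  finally show ?thesis .
qed

text \<open>With \<open>K\<^sub>r = r\<^sup>-\<^sup>Q K \<circ> \<delta>\<^sub>1\<^sub>/\<^sub>r\<close>, the kinetic divergence below is \<open>K\<^sub>1 - K\<^sub>1\<^sub>/\<^sub>2\<close>.\<close>

lemma dyadic_kernel_exists:
  obtains K :: "'n::finite phase \<Rightarrow> real" where "test_fun K" "integral\<^sup>L lborel K = 1"
    "kinetic_divergence (\<lambda>q. K q - 2 ^ kdim TYPE('n) * K (dilate 2 q))"
proof -
  obtain \<Theta> \<beta> :: "real \<Rightarrow> real" where
    sm: "smooth_fun \<Theta>" "smooth_fun \<beta>" and D: "\<And>x. (\<Theta> has_real_derivative \<beta> x) (at x)"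
    and \<Theta>: "\<And>x. x \<le> 0 \<Longrightarrow> \<Theta> x = 0" "\<And>x. x \<ge> 1 \<Longrightarrow> \<Theta> x = 1"
    and \<beta>: "\<And>x. x \<notin> {0..1} \<Longrightarrow> \<beta> x = 0"
    using smooth_step_exists by blast
  define K :: "'n phase \<Rightarrow> real" where "K q = (\<Prod>b\<in>Basis. \<beta> (q \<bullet> b))" for q
  \<comment> \<open>The factors of \<open>dilate 2\<close> along the axes: 2^2 in time, 2^3 in
    position, 2 in velocity.\<close>
  define m :: "'n phase \<Rightarrow> real" where
    "m b = (if b = e_t then 4 else if b \<in> range e_x then 8 else 2)" for b
  have m1: "m b \<ge> 1" for b by (simp add: m_def)
  have scale: "smooth_fun (\<lambda>x. \<phi> (c * x))" if "smooth_fun \<phi>" for \<phi> :: "real \<Rightarrow> real" and c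
    using smooth_fun_affine[OF bounded_linear_mult_right that, of 0] by simp
  have off: "m b * x \<notin> {0..1}" if "x \<notin> {0..1}" for b x
  proof (cases "x < 0")
    case True
    then have "m b * x < 0" using m1[of b] by (intro mult_pos_neg) auto
    then show ?thesis by simp
  next
    case False
    then have "1 < x" using that by simp
    moreover have "1 * x \<le> m b * x" using m1[of b] False by (intro mult_right_mono) auto
    ultimately have "1 < m b * x" by linarith
    then show ?thesis by simp
  qed
  have "kinetic_divergence (\<lambda>q. (\<Prod>b\<in>Basis. \<beta> (q \<bullet> b)) - (\<Prod>b\<in>Basis. m b * \<beta> (m b * (q \<bullet> b))))"
  \<comment> \<open>A primitive of the difference of the two bumps. As \<open>m b\<close> is at
    least 1, both steps are 0 for x \<le> 0 and 1 for x \<ge> 1, so their difference is supported in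
    the unit interval.\<close>
  proof (rule tensor_difference_induct[where \<gamma> = "\<lambda>b x. \<Theta> x + (- 1) * \<Theta> (m b * x)"])
    fix b :: "'n phase" and x :: real
    show "smooth_fun \<beta> \<and> smooth_fun (\<lambda>x. m b * \<beta> (m b * x)) \<and> smooth_fun (\<lambda>x. \<Theta> x + - 1 * \<Theta> (m b * x))"
      by (intro conjI smooth_fun_add smooth_fun_mult smooth_fun_const scale sm)
    have "\<Theta> x + - 1 * \<Theta> (m b * x) = 0" if "x \<notin> {0..1}"
    proof (cases "x \<le> 0")
      case True
      then show ?thesis using m1[of b] by (simp add: \<Theta> mult_nonneg_nonpos)
    next
      case False
      then have "1 \<le> x" using that by simp
      moreover have "1 * 1 \<le> m b * x" using m1[of b] \<open>1 \<le> x\<close> by (intro mult_mono) auto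
      ultimately show ?thesis by (simp add: \<Theta>)
    qed
    then show "x \<notin> {0..1} \<Longrightarrow> \<beta> x = 0 \<and> m b * \<beta> (m b * x) = 0 \<and> \<Theta> x + - 1 * \<Theta> (m b * x) = 0"
      using \<beta>[of x] \<beta>[OF off[of x b]] by auto
    have "((\<lambda>x. \<Theta> (m b * x)) has_real_derivative \<beta> (m b * x) * m b) (at x)"
      by (rule DERIV_chain'[OF _ D]) (auto intro!: derivative_eq_intros)
    from DERIV_add[OF D DERIV_cmult[OF this, of "- 1"]]
    show "((\<lambda>x. \<Theta> x + - 1 * \<Theta> (m b * x)) has_real_derivative \<beta> x - m b * \<beta> (m b * x)) (at x)"
      by (simp add: mult.commute)
  next
    fix b :: "'n phase" and H :: "'n phase \<Rightarrow> real"
    assume "b \<in> Basis" "test_fun H"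
    then show "kinetic_divergence (dderiv b H)"
      unfolding Basis_phase
      using kinetic_divergence_dderiv_t kinetic_divergence_dderiv_x kinetic_divergence_dderiv_v by blast
  qed (auto intro: kinetic_divergence_zero kinetic_divergence_add)
  moreover have "(\<Prod>b\<in>Basis. m b * \<beta> (m b * (q \<bullet> b))) = 2 ^ kdim TYPE('n) * K (dilate 2 q)" for q
  proof -
    have mx: "m (e_x i) = 8" "m (e_v i) = 2" "m e_t = 4" for i
      by (auto simp: m_def)
    \<comment> \<open>The weights \<open>m b\<close> multiply to the Jacobian of
      \<open>dilate 2\<close>.\<close>
    have "(2::real) ^ (2 + 4 * CARD('n)) = 4 * (8 ^ CARD('n) * 2 ^ CARD('n))"
      by (simp add: power_add power_mult power_mult_distrib[symmetric])
    then show ?thesis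
      unfolding K_def prod_Basis_phase mx kdim_def
      by (cases q) (simp add: dilate_def inner_axis prod.distrib)
  qed
  ultimately have "kinetic_divergence (\<lambda>q. K q - 2 ^ kdim TYPE('n) * K (dilate 2 q))"
    by (simp add: K_def)
  moreover have "test_fun K"
    unfolding K_def using sm \<beta> by (intro test_fun_tensor) auto
  moreover have "integral\<^sup>L lborel K = 1"
  proof -
    have "has_bochner_integral lborel (\<lambda>x. \<beta> x * indicator {0..1} x) (\<Theta> 1 - \<Theta> 0)"
      using smooth_fun_continuous[OF sm(2)]
      by (intro has_bochner_integral_FTC_Icc_real D) (simp_all add: continuous_on_eq_continuous_at)
    moreover have "\<beta> x * indicator {0..1} x = \<beta> x" for x
      using \<beta>[of x] by (cases "x \<in> {0..1}") auto
    ultimately have "has_bochner_integral lborel \<beta> 1" by (simp add: \<Theta>)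
    then have "integrable lborel \<beta>" "integral\<^sup>L lborel \<beta> = 1"
      by (auto simp: has_bochner_integral_iff)
    then show ?thesis unfolding K_def by (subst integral_tensor) simp_all
  qed
  ultimately show ?thesis using that by blast
qed

subsection \<open>Kinetic averages\<close>

lemma borel_measurable_fst [measurable (raw)]:
  fixes f :: "'x \<Rightarrow> 'a::topological_space \<times> 'b::topological_space"
  assumes "f \<in> borel_measurable M" shows "(\<lambda>x. fst (f x)) \<in> borel_measurable M"
  by (rule measurable_compose[OF assms borel_measurable_continuous_onI[OF continuous_on_fst[OF continuous_on_id]]])

lemma borel_measurable_snd [measurable (raw)]:
  fixes f :: "'x \<Rightarrow> 'a::topological_space \<times> 'b::topological_space"
  assumes "f \<in> borel_measurable M" shows "(\<lambda>x. snd (f x)) \<in> borel_measurable M"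
  by (rule measurable_compose[OF assms borel_measurable_continuous_onI[OF continuous_on_snd[OF continuous_on_id]]])

section \<open>Galilean changes of variables\<close>

lemma nn_integral_lborel_affine:
  fixes F :: "'a::euclidean_space \<Rightarrow> ennreal"
  assumes [measurable]: "F \<in> borel_measurable borel" and c: "c \<noteq> 0"
  shows "(\<integral>\<^sup>+x. F x \<partial>lborel) = ennreal (\<bar>c\<bar> ^ DIM('a)) * (\<integral>\<^sup>+x. F (t + c *\<^sub>R x) \<partial>lborel)"
  by (subst lborel_affine[OF c, of t]) (simp add: nn_integral_density nn_integral_distr nn_integral_cmult)

text \<open>The position integral stands innermost because the shear below translates y by an amount
  depending on s and w, which are then fixed.\<close>

lemma nn_integral_phase:
  fixes F :: "'n::finite phase \<Rightarrow> ennreal"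
  assumes [measurable]: "F \<in> borel_measurable borel"
  shows "(\<integral>\<^sup>+p. F p \<partial>lborel) = (\<integral>\<^sup>+s. \<integral>\<^sup>+w. \<integral>\<^sup>+y. F (s, y, w) \<partial>lborel \<partial>lborel \<partial>lborel)"
proof -
  have "(\<integral>\<^sup>+p. F p \<partial>lborel) = (\<integral>\<^sup>+p. F p \<partial>(lborel \<Otimes>\<^sub>M lborel))"
    by (simp only: lborel_prod)
  also have "\<dots> = (\<integral>\<^sup>+s. \<integral>\<^sup>+q. F (s, q) \<partial>lborel \<partial>lborel)"
    by (rule lborel.nn_integral_fst[symmetric]) (simp add: lborel_prod)
  also have "\<dots> = (\<integral>\<^sup>+s. \<integral>\<^sup>+q. F (s, q) \<partial>(lborel \<Otimes>\<^sub>M lborel) \<partial>lborel)"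
    by (simp only: lborel_prod)
  also have "\<dots> = (\<integral>\<^sup>+s. \<integral>\<^sup>+w. \<integral>\<^sup>+y. F (s, y, w) \<partial>lborel \<partial>lborel \<partial>lborel)"
    by (intro nn_integral_cong lborel_pair.nn_integral_snd[symmetric]) (simp add: lborel_prod)
  finally show ?thesis .
qed

text \<open>The map is triangular: with s and w fixed, y undergoes a scaling and a translation by
  \<open>\<alpha> s w\<close>, so the shear does not enter the Jacobian. Signed scale factors let
  one statement serve both left and right translations of the group.\<close>

lemma nn_integral_phase_shear:
  fixes F :: "'n::finite phase \<Rightarrow> ennreal" and \<alpha> :: "real \<Rightarrow> real ^ 'n \<Rightarrow> real ^ 'n"
  assumes [measurable]: "F \<in> borel_measurable borel" "case_prod \<alpha> \<in> borel_measurable borel"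
    and nz: "a \<noteq> 0" "b \<noteq> 0" "c \<noteq> 0"
  shows "(\<integral>\<^sup>+p. F p \<partial>lborel) = ennreal (\<bar>a\<bar> * \<bar>b\<bar> ^ CARD('n) * \<bar>c\<bar> ^ CARD('n)) *
    (\<integral>\<^sup>+q. (case q of (s, y, w) \<Rightarrow> F (t + a * s, \<alpha> s w + b *\<^sub>R y, v + c *\<^sub>R w)) \<partial>lborel)"
proof -
  have \<alpha>m [measurable (raw)]: "(\<lambda>x. \<alpha> (f x) (g x)) \<in> borel_measurable M"
    if "f \<in> borel_measurable M" "g \<in> borel_measurable M" for f g and M :: "'x measure"
    using measurable_compose[OF borel_measurable_Pair[OF that] assms(2)] by simp
  have "(\<integral>\<^sup>+p. F p \<partial>lborel) = (\<integral>\<^sup>+s. \<integral>\<^sup>+w. \<integral>\<^sup>+y. F (s, y, w) \<partial>lborel \<partial>lborel \<partial>lborel)"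
    by (rule nn_integral_phase) measurable
  also have "\<dots> = ennreal \<bar>a\<bar> * (\<integral>\<^sup>+s. \<integral>\<^sup>+w. \<integral>\<^sup>+y. F (t + a * s, y, w) \<partial>lborel \<partial>lborel \<partial>lborel)"
    by (subst nn_integral_lborel_affine[OF _ nz(1), where t = t]) simp_all
  also have "(\<integral>\<^sup>+s. \<integral>\<^sup>+w. \<integral>\<^sup>+y. F (t + a * s, y, w) \<partial>lborel \<partial>lborel \<partial>lborel)
      = (\<integral>\<^sup>+s. ennreal (\<bar>c\<bar> ^ CARD('n)) * (\<integral>\<^sup>+w. \<integral>\<^sup>+y. F (t + a * s, y, v + c *\<^sub>R w) \<partial>lborel \<partial>lborel) \<partial>lborel)"
    by (intro nn_integral_cong, subst nn_integral_lborel_affine[OF _ nz(3), where t = v]) simp_all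
  also have "\<dots> = (\<integral>\<^sup>+s. ennreal (\<bar>c\<bar> ^ CARD('n)) * (\<integral>\<^sup>+w. ennreal (\<bar>b\<bar> ^ CARD('n)) *
      (\<integral>\<^sup>+y. F (t + a * s, \<alpha> s w + b *\<^sub>R y, v + c *\<^sub>R w) \<partial>lborel) \<partial>lborel) \<partial>lborel)"
    by (intro nn_integral_cong arg_cong2[where f = "(*)"] refl,
        subst nn_integral_lborel_affine[OF _ nz(2)]) simp_all
  also have "\<dots> = ennreal (\<bar>b\<bar> ^ CARD('n) * \<bar>c\<bar> ^ CARD('n)) * (\<integral>\<^sup>+s. \<integral>\<^sup>+w.
      \<integral>\<^sup>+y. F (t + a * s, \<alpha> s w + b *\<^sub>R y, v + c *\<^sub>R w) \<partial>lborel \<partial>lborel \<partial>lborel)"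
    by (simp add: nn_integral_cmult ennreal_mult mult_ac)
  also have "(\<integral>\<^sup>+s. \<integral>\<^sup>+w. \<integral>\<^sup>+y. F (t + a * s, \<alpha> s w + b *\<^sub>R y, v + c *\<^sub>R w) \<partial>lborel \<partial>lborel \<partial>lborel)
      = (\<integral>\<^sup>+q. (case q of (s, y, w) \<Rightarrow> F (t + a * s, \<alpha> s w + b *\<^sub>R y, v + c *\<^sub>R w)) \<partial>lborel)"
    unfolding split_beta by (subst nn_integral_phase) simp_all
  finally show ?thesis by (simp add: ennreal_mult mult_ac)
qed

text \<open>With the group law \<open>(t, x, v) \<circ> (s, y, w) = (t + s, x + y + s v, v + w)\<close> and the dilations
  \<open>\<delta>\<^sub>r\<close>: \<open>gap r p z\<close> is \<open>\<delta>\<^sub>1\<^sub>/\<^sub>r (p\<^sup>-\<^sup>1 \<circ> z)\<close>, and \<open>kmul r p\<close>, \<open>kdiv r z\<close> solve \<open>gap r p z = q\<close>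
  for \<open>z\<close> and for \<open>p\<close>.\<close>

definition gap :: "real \<Rightarrow> 'n::finite phase \<Rightarrow> 'n phase \<Rightarrow> 'n phase" where
  "gap r = (\<lambda>(t, x, v) (\<tau>, \<xi>, \<eta>).
     ((\<tau> - t) / r ^ 2, (\<xi> - x - (\<tau> - t) *\<^sub>R v) /\<^sub>R r ^ 3, (\<eta> - v) /\<^sub>R r))"

definition kmul :: "real \<Rightarrow> 'n::finite phase \<Rightarrow> 'n phase \<Rightarrow> 'n phase" where
  "kmul r = (\<lambda>(t, x, v) (s, y, w).
     (t + r ^ 2 * s, x + (r ^ 2 * s) *\<^sub>R v + r ^ 3 *\<^sub>R y, v + r *\<^sub>R w))"

definition kdiv :: "real \<Rightarrow> 'n::finite phase \<Rightarrow> 'n phase \<Rightarrow> 'n phase" where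
  "kdiv r = (\<lambda>(\<tau>, \<xi>, \<eta>) (s, y, w).
     (\<tau> + (- (r ^ 2)) * s, \<xi> - (r ^ 2 * s) *\<^sub>R (\<eta> - r *\<^sub>R w) + (- (r ^ 3)) *\<^sub>R y, \<eta> + (- r) *\<^sub>R w))"

lemma gap_kmul: "r > 0 \<Longrightarrow> gap r p (kmul r p q) = q"
  by (cases p; cases q) (simp add: gap_def kmul_def)

lemma kmul_gap: "r > 0 \<Longrightarrow> kmul r p (gap r p z) = z"
  by (cases p; cases z) (simp add: gap_def kmul_def)

lemma gap_kdiv: "r > 0 \<Longrightarrow> gap r (kdiv r z q) z = q"
  by (cases z; cases q) (simp add: gap_def kdiv_def algebra_simps)

lemma gap_borel [measurable (raw)]:
  assumes [measurable]: "f \<in> borel_measurable M" "g \<in> borel_measurable M"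
  shows "(\<lambda>x. gap r (f x) (g x)) \<in> borel_measurable M"
proof -
  have "(\<lambda>x. ((fst (g x) - fst (f x)) / r ^ 2,
      (fst (snd (g x)) - fst (snd (f x)) - (fst (g x) - fst (f x)) *\<^sub>R snd (snd (f x))) /\<^sub>R r ^ 3,
      (snd (snd (g x)) - snd (snd (f x))) /\<^sub>R r)) \<in> borel_measurable M"
    by measurable
  then show ?thesis by (simp add: gap_def split_beta)
qed

lemma kdim_power:
  "\<bar>r ^ 2\<bar> * \<bar>r ^ 3\<bar> ^ CARD('n) * \<bar>r\<bar> ^ CARD('n) = r ^ kdim TYPE('n::finite)" if "r > 0" for r :: real
proof -
  have "r ^ (2 + 4 * CARD('n)) = r ^ 2 * (r ^ 3 * r) ^ CARD('n)"
    by (simp add: power_add power_mult numeral_eq_Suc power_mult_distrib mult_ac)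
  then show ?thesis using that by (simp add: kdim_def power_mult_distrib)
qed

lemma nn_integral_kmul:
  fixes F :: "'n::finite phase \<Rightarrow> ennreal"
  assumes [measurable]: "F \<in> borel_measurable borel" and r: "r > 0"
  shows "(\<integral>\<^sup>+z. F z \<partial>lborel) = ennreal (r ^ kdim TYPE('n)) * (\<integral>\<^sup>+q. F (kmul r p q) \<partial>lborel)"
proof -
  obtain t x v where p: "p = (t, x, v)" by (cases p)
  have "(\<lambda>(s, w). x + (r ^ 2 * s) *\<^sub>R v) \<in> borel_measurable borel"
    unfolding split_beta by (intro borel_measurable_continuous_onI continuous_intros)
  from nn_integral_phase_shear[OF assms(1) this, of "r ^ 2" "r ^ 3" r t v] r show ?thesis
    by (simp only: kdim_power[OF r]) (simp add: p kmul_def split_beta)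
qed

lemma nn_integral_kdiv:
  fixes F :: "'n::finite phase \<Rightarrow> ennreal"
  assumes [measurable]: "F \<in> borel_measurable borel" and r: "r > 0"
  shows "(\<integral>\<^sup>+p. F p \<partial>lborel) = ennreal (r ^ kdim TYPE('n)) * (\<integral>\<^sup>+q. F (kdiv r z q) \<partial>lborel)"
proof -
  obtain \<tau> \<xi> \<eta> where z: "z = (\<tau>, \<xi>, \<eta>)" by (cases z)
  have "(\<lambda>(s, w). \<xi> - (r ^ 2 * s) *\<^sub>R (\<eta> - r *\<^sub>R w)) \<in> borel_measurable borel"
    unfolding split_beta by (intro borel_measurable_continuous_onI continuous_intros)
  \<comment> \<open>Solving for p inverts the group element, hence the negative scale factors; only
    their absolute values enter the Jacobian.\<close>
  from nn_integral_phase_shear[OF assms(1) this, of "- (r ^ 2)" "- (r ^ 3)" "- r" \<tau> \<eta>] r show ?thesis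
    unfolding abs_minus_cancel by (simp only: kdim_power[OF r]) (simp add: z kdiv_def split_beta)
qed

lemma nn_integral_lborel_pair:
  fixes F :: "'a::euclidean_space \<times> 'b::euclidean_space \<Rightarrow> ennreal"
  assumes "F \<in> borel_measurable borel"
  shows "(\<integral>\<^sup>+x. F x \<partial>lborel) = (\<integral>\<^sup>+p. \<integral>\<^sup>+z. F (p, z) \<partial>lborel \<partial>lborel)"
    "(\<integral>\<^sup>+x. F x \<partial>lborel) = (\<integral>\<^sup>+z. \<integral>\<^sup>+p. F (p, z) \<partial>lborel \<partial>lborel)"
proof -
  have m: "F \<in> borel_measurable (lborel \<Otimes>\<^sub>M lborel)" using assms by (simp add: lborel_prod)
  show "(\<integral>\<^sup>+x. F x \<partial>lborel) = (\<integral>\<^sup>+p. \<integral>\<^sup>+z. F (p, z) \<partial>lborel \<partial>lborel)"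
    using lborel.nn_integral_fst[OF m] by (simp add: lborel_prod)
  show "(\<integral>\<^sup>+x. F x \<partial>lborel) = (\<integral>\<^sup>+z. \<integral>\<^sup>+p. F (p, z) \<partial>lborel \<partial>lborel)"
    using lborel_pair.nn_integral_snd[OF m] by (simp add: lborel_prod)
qed

text \<open>Integrate the kernel first, in the variable on which \<open>u\<close> does not depend.
  By \<open>kmul\<close> in z, or \<open>kdiv\<close> in p, its mass is r^Q times that of
  \<open>k\<close>, whichever point is held fixed: Lebesgue measure is invariant under translations
  of the group from both sides.\<close>

lemma has_bochner_integral_gap:
  fixes u k :: "'n::finite phase \<Rightarrow> real"
  assumes int: "integrable lborel u" "integrable lborel k" and nn: "\<And>p. u p \<ge> 0" "\<And>q. k q \<ge> 0"
    and r: "r > 0"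
  shows "has_bochner_integral lborel (\<lambda>(p, z). u p * k (gap r p z))
      (r ^ kdim TYPE('n) * integral\<^sup>L lborel u * integral\<^sup>L lborel k)"
    and "has_bochner_integral lborel (\<lambda>(p, z). u z * k (gap r p z))
      (r ^ kdim TYPE('n) * integral\<^sup>L lborel u * integral\<^sup>L lborel k)"
proof -
  have [measurable]: "u \<in> borel_measurable borel" "k \<in> borel_measurable borel"
    using int[THEN borel_measurable_integrable] by simp_all
  have I: "(\<integral>\<^sup>+p. ennreal (u p) \<partial>lborel) = ennreal (integral\<^sup>L lborel u)"
    "(\<integral>\<^sup>+p. ennreal (k p) \<partial>lborel) = ennreal (integral\<^sup>L lborel k)"
    using int nn by (auto intro!: nn_integral_eq_integral)
  have pos: "0 \<le> r ^ kdim TYPE('n) * integral\<^sup>L lborel u * integral\<^sup>L lborel k"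
    using nn r by (intro mult_nonneg_nonneg integral_nonneg) auto
  have val: "ennreal (integral\<^sup>L lborel u) * (ennreal (r ^ kdim TYPE('n)) * ennreal (integral\<^sup>L lborel k))
      = ennreal (r ^ kdim TYPE('n) * integral\<^sup>L lborel u * integral\<^sup>L lborel k)"
    using nn r by (simp add: ennreal_mult[symmetric] integral_nonneg mult_ac)
  have kz: "(\<integral>\<^sup>+z. ennreal (k (gap r p z)) \<partial>lborel) = ennreal (r ^ kdim TYPE('n)) * ennreal (integral\<^sup>L lborel k)" for p
    by (subst nn_integral_kmul[OF _ r, of _ p]) (simp_all add: gap_kmul[OF r] I)
  have kp: "(\<integral>\<^sup>+p. ennreal (k (gap r p z)) \<partial>lborel) = ennreal (r ^ kdim TYPE('n)) * ennreal (integral\<^sup>L lborel k)" for z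
    by (subst nn_integral_kdiv[OF _ r, of _ z]) (simp_all add: gap_kdiv[OF r] I)
  show "has_bochner_integral lborel (\<lambda>(p, z). u p * k (gap r p z))
      (r ^ kdim TYPE('n) * integral\<^sup>L lborel u * integral\<^sup>L lborel k)"
  proof (rule has_bochner_integral_nn_integral)
    have "(\<integral>\<^sup>+x. ennreal (case x of (p, z) \<Rightarrow> u p * k (gap r p z)) \<partial>lborel)
      = (\<integral>\<^sup>+p. ennreal (u p) * (\<integral>\<^sup>+z. ennreal (k (gap r p z)) \<partial>lborel) \<partial>lborel)"
      unfolding split_beta
      by (subst nn_integral_lborel_pair(1)) (simp_all add: nn ennreal_mult nn_integral_cmult)
    then show "(\<integral>\<^sup>+x. ennreal (case x of (p, z) \<Rightarrow> u p * k (gap r p z)) \<partial>lborel)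
      = ennreal (r ^ kdim TYPE('n) * integral\<^sup>L lborel u * integral\<^sup>L lborel k)"
      by (simp add: kz nn_integral_multc I val)
  qed (use nn pos in \<open>auto simp: split_beta\<close>)
  show "has_bochner_integral lborel (\<lambda>(p, z). u z * k (gap r p z))
      (r ^ kdim TYPE('n) * integral\<^sup>L lborel u * integral\<^sup>L lborel k)"
  proof (rule has_bochner_integral_nn_integral)
    have "(\<integral>\<^sup>+x. ennreal (case x of (p, z) \<Rightarrow> u z * k (gap r p z)) \<partial>lborel)
      = (\<integral>\<^sup>+z. ennreal (u z) * (\<integral>\<^sup>+p. ennreal (k (gap r p z)) \<partial>lborel) \<partial>lborel)"
      unfolding split_beta
      by (subst nn_integral_lborel_pair(2)) (simp_all add: nn ennreal_mult nn_integral_cmult)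
    then show "(\<integral>\<^sup>+x. ennreal (case x of (p, z) \<Rightarrow> u z * k (gap r p z)) \<partial>lborel)
      = ennreal (r ^ kdim TYPE('n) * integral\<^sup>L lborel u * integral\<^sup>L lborel k)"
      by (simp add: kp nn_integral_multc I val)
  qed (use nn pos in \<open>auto simp: split_beta\<close>)
qed

section \<open>The averaged bilinear form and its Schur bound\<close>

lemma L2_fun_real: "L2_fun g \<longleftrightarrow> g \<in> borel_measurable borel \<and> integrable lborel (\<lambda>p. (g p)\<^sup>2)"
  for g :: "'a::euclidean_space \<Rightarrow> real"
  by (simp add: L2_fun_def)

text \<open>Schur's test. Pointwise |\<psi> g| \<le> l \<psi>^2 + g^2 / l, and each square is
  integrated against |h| with the kernel mass of the other variable. The weight \<open>l\<close>
  stays free so that the bound involves squared norms only.\<close>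

lemma gap_form_bound:
  fixes g h \<psi> :: "'n::finite phase \<Rightarrow> real"
  assumes g: "L2_fun g" and \<psi>: "L2_fun \<psi>" and h: "integrable lborel h" and r: "r > 0" and l: "l > 0"
  shows "integrable lborel (\<lambda>(p, z). \<psi> p * (g z * h (gap r p z)))"
    and "\<bar>integral\<^sup>L lborel (\<lambda>(p, z). \<psi> p * (g z * h (gap r p z)))\<bar>
      \<le> r ^ kdim TYPE('n) * (\<integral>q. \<bar>h q\<bar> \<partial>lborel) *
        (l * (\<integral>p. (\<psi> p)\<^sup>2 \<partial>lborel) + (\<integral>z. (g z)\<^sup>2 \<partial>lborel) / l)"
proof -
  let ?f = "\<lambda>(p, z). \<psi> p * (g z * h (gap r p z))"
  let ?Q = "r ^ kdim TYPE('n)" and ?h = "\<integral>q. \<bar>h q\<bar> \<partial>lborel"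
  have [measurable]: "g \<in> borel_measurable borel" "\<psi> \<in> borel_measurable borel" "h \<in> borel_measurable borel"
    using g \<psi> borel_measurable_integrable[OF h] by (auto simp: L2_fun_real)
  define B where "B = (\<lambda>x. l * (case x of (p, z) \<Rightarrow> (\<psi> p)\<^sup>2 * \<bar>h (gap r p z)\<bar>)
      + (case x of (p, z) \<Rightarrow> (g z)\<^sup>2 * \<bar>h (gap r p z)\<bar>) / l)"
  have "has_bochner_integral lborel (\<lambda>(p, z). (\<psi> p)\<^sup>2 * \<bar>h (gap r p z)\<bar>) (?Q * (\<integral>p. (\<psi> p)\<^sup>2 \<partial>lborel) * ?h)"
    "has_bochner_integral lborel (\<lambda>(p, z). (g z)\<^sup>2 * \<bar>h (gap r p z)\<bar>) (?Q * (\<integral>p. (g p)\<^sup>2 \<partial>lborel) * ?h)"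
    using g \<psi> h r by (auto intro!: has_bochner_integral_gap simp: L2_fun_real)
  then have B: "has_bochner_integral lborel B
      (l * (?Q * (\<integral>p. (\<psi> p)\<^sup>2 \<partial>lborel) * ?h) + (?Q * (\<integral>p. (g p)\<^sup>2 \<partial>lborel) * ?h) / l)"
    unfolding B_def
    by (intro has_bochner_integral_add has_bochner_integral_mult_right has_bochner_integral_divide_zero)
  have bound: "\<bar>?f x\<bar> \<le> B x" for x
  proof -
    obtain p z where x: "x = (p, z)" by (cases x)
    let ?a = "\<bar>\<psi> p\<bar>" and ?b = "\<bar>g z\<bar>" and ?k = "\<bar>h (gap r p z)\<bar>"
    have "2 * (l * ?a) * ?b \<le> (l * ?a)\<^sup>2 + ?b\<^sup>2" by (rule sum_squares_bound)
    moreover have "0 \<le> (l * ?a) * ?b" using l by simp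
    moreover have "l * (l * ?a\<^sup>2 + ?b\<^sup>2 / l) = (l * ?a)\<^sup>2 + ?b\<^sup>2"
      using l by (simp add: distrib_left power_mult_distrib power2_eq_square[of l])
    ultimately have "l * (?a * ?b) \<le> l * (l * ?a\<^sup>2 + ?b\<^sup>2 / l)"
      by (simp only: mult.assoc)
    then have "?a * ?b \<le> l * ?a\<^sup>2 + ?b\<^sup>2 / l" using l by (simp only: mult_le_cancel_left_pos)
    then have "?a * ?b * ?k \<le> (l * ?a\<^sup>2 + ?b\<^sup>2 / l) * ?k" by (rule mult_right_mono) simp
    then show ?thesis by (simp add: x B_def abs_mult algebra_simps)
  qed
  show int: "integrable lborel ?f"
    by (rule Bochner_Integration.integrable_bound[OF integrable.intros[OF B]])
      (use bound in \<open>auto simp: split_beta intro!: AE_I2 order_trans[OF _ abs_ge_self]\<close>)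
  have "\<bar>integral\<^sup>L lborel ?f\<bar> \<le> (\<integral>x. \<bar>?f x\<bar> \<partial>lborel)" by (rule integral_abs_bound)
  also have "\<dots> \<le> integral\<^sup>L lborel B"
    by (intro integral_mono integrable_abs int integrable.intros[OF B] bound)
  also have "\<dots> = l * (?Q * (\<integral>p. (\<psi> p)\<^sup>2 \<partial>lborel) * ?h) + (?Q * (\<integral>p. (g p)\<^sup>2 \<partial>lborel) * ?h) / l"
    by (rule has_bochner_integral_integral_eq[OF B])
  finally show "\<bar>integral\<^sup>L lborel ?f\<bar>
      \<le> ?Q * ?h * (l * (\<integral>p. (\<psi> p)\<^sup>2 \<partial>lborel) + (\<integral>z. (g z)\<^sup>2 \<partial>lborel) / l)"
    by (simp add: algebra_simps)
qed

text \<open>The pairing of \<open>\<psi>\<close> with the average of \<open>g\<close>, left without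
  the factor r^-Q; the normalisation is restored where different scales are compared.\<close>

definition gap_form :: "real \<Rightarrow> ('n::finite phase \<Rightarrow> real) \<Rightarrow> ('n phase \<Rightarrow> real) \<Rightarrow> ('n phase \<Rightarrow> real) \<Rightarrow> real" where
  "gap_form r \<psi> g h = integral\<^sup>L lborel (\<lambda>(p, z). \<psi> p * (g z * h (gap r p z)))"

text \<open>With p outside, the inner integral is a weak equation in z for a fixed centre p; with z
  outside, the average falls on \<open>\<psi>\<close>, which gives the limit at small
  scales.\<close>

lemma gap_form_fubini:
  assumes "L2_fun g" "L2_fun \<psi>" "integrable lborel h" "r > 0"
  shows "gap_form r \<psi> g h = (\<integral>p. \<psi> p * (\<integral>z. g z * h (gap r p z) \<partial>lborel) \<partial>lborel)"
    and "integrable lborel (\<lambda>p. \<psi> p * (\<integral>z. g z * h (gap r p z) \<partial>lborel))"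
    and "gap_form r \<psi> g h = (\<integral>z. g z * (\<integral>p. \<psi> p * h (gap r p z) \<partial>lborel) \<partial>lborel)"
proof -
  have I: "integrable (lborel \<Otimes>\<^sub>M lborel) (\<lambda>(p, z). \<psi> p * (g z * h (gap r p z)))"
    using gap_form_bound(1)[OF assms, of 1] by (simp add: lborel_prod)
  show "gap_form r \<psi> g h = (\<integral>p. \<psi> p * (\<integral>z. g z * h (gap r p z) \<partial>lborel) \<partial>lborel)"
    using lborel_pair.integral_fst'[OF I] by (simp add: gap_form_def lborel_prod)
  show "integrable lborel (\<lambda>p. \<psi> p * (\<integral>z. g z * h (gap r p z) \<partial>lborel))"
    using lborel_pair.integrable_fst'[OF I] by simp
  have "(\<integral>z. \<integral>p. \<psi> p * (g z * h (gap r p z)) \<partial>lborel \<partial>lborel) = gap_form r \<psi> g h"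
    using lborel_pair.integral_snd[OF I] by (simp add: gap_form_def lborel_prod)
  moreover have "(\<integral>p. \<psi> p * (g z * h (gap r p z)) \<partial>lborel) = g z * (\<integral>p. \<psi> p * h (gap r p z) \<partial>lborel)" for z
    by (subst integral_mult_right_zero[symmetric]) (simp add: mult_ac)
  ultimately show "gap_form r \<psi> g h = (\<integral>z. g z * (\<integral>p. \<psi> p * h (gap r p z) \<partial>lborel) \<partial>lborel)"
    by simp
qed

lemma gap_form_add:
  assumes "L2_fun g" "L2_fun \<psi>" "integrable lborel h" "integrable lborel k" "r > 0"
  shows "gap_form r \<psi> g (\<lambda>q. h q + k q) = gap_form r \<psi> g h + gap_form r \<psi> g k"
proof -
  have "gap_form r \<psi> g (\<lambda>q. h q + k q) = integral\<^sup>L lborel (\<lambda>x. (case x of (p, z) \<Rightarrow> \<psi> p * (g z * h (gap r p z)))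
      + (case x of (p, z) \<Rightarrow> \<psi> p * (g z * k (gap r p z))))"
    by (auto simp: gap_form_def split_beta algebra_simps intro!: Bochner_Integration.integral_cong)
  also have "\<dots> = gap_form r \<psi> g h + gap_form r \<psi> g k"
    unfolding gap_form_def
    using assms by (intro Bochner_Integration.integral_add gap_form_bound(1)[where l = 1]) auto
  finally show ?thesis .
qed

lemma gap_form_sum:
  assumes "L2_fun g" "L2_fun \<psi>" "\<And>i. i \<in> I \<Longrightarrow> integrable lborel (h i)" "r > 0"
  shows "gap_form r \<psi> g (\<lambda>q. \<Sum>i\<in>I. h i q) = (\<Sum>i\<in>I. gap_form r \<psi> g (h i))"
  using assms(3)
proof (induction I rule: infinite_finite_induct)
  case (insert i I)
  then show ?case using gap_form_add[OF assms(1,2) _ _ assms(4), of "h i" "\<lambda>q. \<Sum>i\<in>I. h i q"] by simp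
qed (simp_all add: gap_form_def case_prod_unfold)

section \<open>Weak equations tested against translated kernels\<close>

definition gap_linear :: "real \<Rightarrow> 'n::finite phase \<Rightarrow> 'n phase \<Rightarrow> 'n phase" where
  "gap_linear r p z = (fst z / r ^ 2, (fst (snd z) - fst z *\<^sub>R snd (snd p)) /\<^sub>R r ^ 3, snd (snd z) /\<^sub>R r)"

lemma bounded_linear_gap_linear: "bounded_linear (gap_linear r p)"
proof -
  have "linear (gap_linear r p)"
    by (rule linearI) (auto simp: gap_linear_def algebra_simps add_divide_distrib)
  then show ?thesis by (rule linear_conv_bounded_linear[THEN iffD1])
qed

text \<open>The shear term of \<open>gap\<close> multiplies the time difference by the velocity of
  p, not of z, so for fixed p the map is affine in z. Smoothness of translated kernels and the chain
  rule follow from the affine case.\<close>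

lemma gap_affine: "gap r p z = gap r p 0 + gap_linear r p z"
  by (cases p; cases z) (simp add: gap_def gap_linear_def zero_prod_def algebra_simps diff_divide_distrib)

lemma gap_linear_v: "gap_linear r p (0, 0, e) = (1 / r) *\<^sub>R (0, 0, e)"
  by (simp add: gap_linear_def divide_inverse)

text \<open>Galilean invariance together with homogeneity of degree 2: the position slot is the
  velocity difference over r^3, and that difference over r is the velocity of
  \<open>gap r p z\<close>. The transport direction at z thus becomes a multiple of the transport
  direction at the image point.\<close>

lemma gap_linear_transport:
  "r > 0 \<Longrightarrow> gap_linear r p (1, 0, 0) + gap_linear r p (0, snd (snd z), 0) = (1 / r ^ 2) *\<^sub>R (1, snd (snd (gap r p z)), 0)"
  by (cases p; cases z) (simp add: gap_def gap_linear_def algebra_simps numeral_eq_Suc divide_inverse)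

text \<open>The inverse map \<open>kmul r p\<close> is continuous, so it carries the bounded support
  of \<open>\<phi>\<close> back to a bounded set.\<close>

lemma test_fun_gap:
  assumes \<phi>: "test_fun \<phi>" and r: "r > 0"
  shows "test_fun (\<lambda>z. \<phi> (gap r p z))"
proof -
  obtain R where R: "\<And>q. \<phi> q \<noteq> 0 \<Longrightarrow> norm q \<le> R" using \<phi> test_fun_iff by blast
  have "smooth_fun (\<lambda>z. \<phi> (gap r p 0 + gap_linear r p z))"
    by (rule smooth_fun_affine[OF bounded_linear_gap_linear test_fun_smooth[OF \<phi>]])
  then have sm: "smooth_fun (\<lambda>z. \<phi> (gap r p z))" by (simp only: gap_affine[symmetric])
  have "continuous_on (cball 0 R) (kmul r p)"
    by (cases p) (simp add: kmul_def split_beta, intro continuous_intros)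
  then have "bounded (kmul r p ` cball 0 R)"
    by (intro compact_imp_bounded compact_continuous_image) auto
  then obtain R' where "\<forall>z\<in>kmul r p ` cball 0 R. norm z \<le> R'"
    unfolding bounded_iff by blast
  then have R': "norm (kmul r p q) \<le> R'" if "norm q \<le> R" for q
    using that by simp
  have "norm z \<le> R'" if "\<phi> (gap r p z) \<noteq> 0" for z
    using R'[OF R[OF that]] by (simp add: kmul_gap[OF r])
  with sm show ?thesis unfolding test_fun_iff by blast
qed

lemma frechet_derivative_gap:
  assumes "smooth_fun \<phi>"
  shows "frechet_derivative (\<lambda>z. \<phi> (gap r p z)) (at z) w = frechet_derivative \<phi> (at (gap r p z)) (gap_linear r p w)"
proof -
  have "frechet_derivative (\<lambda>z. \<phi> (gap r p 0 + gap_linear r p z)) (at z) w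
      = frechet_derivative \<phi> (at (gap r p 0 + gap_linear r p z)) (gap_linear r p w)"
    by (rule dderiv_affine[OF bounded_linear_gap_linear assms])
  then show ?thesis by (simp only: gap_affine[symmetric])
qed

lemma L2_test_integrable:
  assumes g: "L2_fun g" and \<phi>: "test_fun (\<phi> :: 'a::euclidean_space \<Rightarrow> real)"
  shows "integrable lborel (\<lambda>z. g z * \<phi> z)"
proof (rule Bochner_Integration.integrable_bound)
  have "test_fun (\<lambda>z. \<phi> z * \<phi> z)" by (rule test_fun_mult_smooth[OF test_fun_smooth[OF \<phi>] \<phi>])
  from test_fun_integrable[OF this] show "integrable lborel (\<lambda>z. (g z)\<^sup>2 + (\<phi> z)\<^sup>2)"
    using g by (intro Bochner_Integration.integrable_add) (simp_all add: L2_fun_real power2_eq_square)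
  show "(\<lambda>z. g z * \<phi> z) \<in> borel_measurable lborel"
    using g test_fun_borel[OF \<phi>] unfolding L2_fun_real measurable_lborel2
    by (intro borel_measurable_times) auto
  have "\<bar>g z * \<phi> z\<bar> \<le> (g z)\<^sup>2 + (\<phi> z)\<^sup>2" for z
  proof -
    have "2 * \<bar>g z\<bar> * \<bar>\<phi> z\<bar> \<le> \<bar>g z\<bar>\<^sup>2 + \<bar>\<phi> z\<bar>\<^sup>2" by (rule sum_squares_bound)
    moreover have "0 \<le> \<bar>g z\<bar> * \<bar>\<phi> z\<bar>" by simp
    ultimately show ?thesis unfolding abs_mult power2_abs by linarith
  qed
  then show "AE z in lborel. norm (g z * \<phi> z) \<le> norm ((g z)\<^sup>2 + (\<phi> z)\<^sup>2)" by simp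
qed

lemma L2_fun_component:
  fixes S :: "'a::euclidean_space \<Rightarrow> real ^ 'n"
  assumes "L2_fun S"
  shows "L2_fun (\<lambda>z. S z $ i)" "(\<Sum>i\<in>UNIV. \<integral>z. (S z $ i)\<^sup>2 \<partial>lborel) = (\<integral>z. (norm (S z))\<^sup>2 \<partial>lborel)"
proof -
  have norm2: "(norm (w :: real ^ 'n))\<^sup>2 = (\<Sum>i\<in>UNIV. (w $ i)\<^sup>2)" for w
    unfolding power2_norm_eq_inner by (simp add: inner_vec_def power2_eq_square)
  have m [measurable]: "S \<in> borel_measurable borel" using assms by (simp add: L2_fun_def)
  have mi [measurable]: "(\<lambda>z. S z $ i) \<in> borel_measurable borel" for i
    by (rule measurable_compose[OF m borel_measurable_continuous_onI[OF linear_continuous_on[OF bounded_linear_vec_nth]]])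
  have int: "integrable lborel (\<lambda>z. (S z $ i)\<^sup>2)" for i
  proof (rule Bochner_Integration.integrable_bound)
    show "integrable lborel (\<lambda>z. (norm (S z))\<^sup>2)" using assms by (simp add: L2_fun_def)
    have "(S z $ i)\<^sup>2 \<le> (norm (S z))\<^sup>2" for z
      unfolding norm2 by (rule member_le_sum) auto
    then show "AE z in lborel. norm ((S z $ i)\<^sup>2) \<le> norm ((norm (S z))\<^sup>2)" by simp
  qed simp
  show "L2_fun (\<lambda>z. S z $ i)" using int by (simp add: L2_fun_real)
  show "(\<Sum>i\<in>UNIV. \<integral>z. (S z $ i)\<^sup>2 \<partial>lborel) = (\<integral>z. (norm (S z))\<^sup>2 \<partial>lborel)"
    unfolding norm2 by (rule Bochner_Integration.integral_sum[symmetric]) (rule int)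
qed

text \<open>For each centre p, test the kinetic equation with \<open>A (gap r p z)\<close>.
  Transport on the left brings the factor 1/r^2, the v-gradient paired with S only 1/r; one power of
  r remains as gain.\<close>

lemma gap_form_transport:
  assumes eq: "kinetic_eq f S" and f: "L2_fun f" and S: "L2_fun S" and \<psi>: "L2_fun \<psi>"
    and A: "test_fun A" and r: "r > 0"
  shows "gap_form r \<psi> f (transport A) = r * (\<Sum>i\<in>UNIV. gap_form r \<psi> (\<lambda>z. S z $ i) (dderiv (e_v i) A))"
proof -
  have sm: "smooth_fun A" by (rule test_fun_smooth[OF A])
  have lin: "linear (frechet_derivative A (at q))" for q
    by (rule linear_frechet_derivative[OF smooth_fun_differentiable[OF sm]])
  have inner: "(\<integral>z. f z * transport A (gap r p z) \<partial>lborel)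
      = r * (\<Sum>i\<in>UNIV. \<integral>z. S z $ i * dderiv (e_v i) A (gap r p z) \<partial>lborel)" for p
  proof -
    let ?\<phi> = "\<lambda>z. A (gap r p z)"
    have L: "(\<lambda>(t, x, v). f (t, x, v) * (frechet_derivative ?\<phi> (at (t, x, v)) (1, 0, 0)
        + frechet_derivative ?\<phi> (at (t, x, v)) (0, v, 0))) = (\<lambda>z. (1 / r ^ 2) * (f z * transport A (gap r p z)))"
    proof (rule ext)
      fix z :: "'a phase"
      obtain t x v where z: "z = (t, x, v)" by (cases z)
      have "frechet_derivative ?\<phi> (at z) (1, 0, 0) + frechet_derivative ?\<phi> (at z) (0, v, 0)
        = frechet_derivative A (at (gap r p z)) (gap_linear r p (1, 0, 0) + gap_linear r p (0, v, 0))"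
        by (simp only: frechet_derivative_gap[OF sm] linear_add[OF lin])
      also have "gap_linear r p (1, 0, 0) + gap_linear r p (0, v, 0) = (1 / r ^ 2) *\<^sub>R (1, snd (snd (gap r p z)), 0)"
        using gap_linear_transport[OF r, of p z] by (simp add: z)
      also have "frechet_derivative A (at (gap r p z)) \<dots> = (1 / r ^ 2) * transport A (gap r p z)"
        by (simp only: linear_scale[OF lin] transport_def real_scaleR_def)
      finally show "(case z of (t, x, v) \<Rightarrow> f (t, x, v) * (frechet_derivative ?\<phi> (at (t, x, v)) (1, 0, 0)
        + frechet_derivative ?\<phi> (at (t, x, v)) (0, v, 0))) = (1 / r ^ 2) * (f z * transport A (gap r p z))"
        by (simp add: z)
    qed
    have R: "frechet_derivative ?\<phi> (at z) (0, 0, S z)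
        = (1 / r) * (\<Sum>i\<in>UNIV. S z $ i * dderiv (e_v i) A (gap r p z))" for z
    proof -
      have "(0, 0, S z) = (\<Sum>i\<in>UNIV. (S z $ i) *\<^sub>R e_v i)"
        using vec_axis_expansion[of "S z"] by (simp add: prod_eq_iff fst_sum snd_sum)
      then show ?thesis
        unfolding frechet_derivative_gap[OF sm] gap_linear_v linear_scale[OF lin]
        by (simp only: linear_sum[OF lin] linear_scale[OF lin] real_scaleR_def)
    qed
    have "(1 / r ^ 2) * (\<integral>z. f z * transport A (gap r p z) \<partial>lborel)
        = (\<integral>z. frechet_derivative ?\<phi> (at z) (0, 0, S z) \<partial>lborel)"
      using eq[unfolded kinetic_eq_def, rule_format, OF test_fun_gap[OF A r, of p]] unfolding L by simp
    also have "\<dots> = (1 / r) * (\<integral>z. (\<Sum>i\<in>UNIV. S z $ i * dderiv (e_v i) A (gap r p z)) \<partial>lborel)"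
      unfolding R by simp
    also have "(\<integral>z. (\<Sum>i\<in>UNIV. S z $ i * dderiv (e_v i) A (gap r p z)) \<partial>lborel)
        = (\<Sum>i\<in>UNIV. \<integral>z. S z $ i * dderiv (e_v i) A (gap r p z) \<partial>lborel)"
      by (intro Bochner_Integration.integral_sum L2_test_integrable L2_fun_component(1)[OF S]
          test_fun_gap[OF test_fun_dderiv[OF A] r])
    finally show ?thesis using r by (simp add: field_simps power2_eq_square)
  qed
  have "gap_form r \<psi> f (transport A) = (\<integral>p. \<psi> p * (\<integral>z. f z * transport A (gap r p z) \<partial>lborel) \<partial>lborel)"
    by (rule gap_form_fubini(1)[OF f \<psi> test_fun_integrable[OF test_fun_transport[OF A]] r])
  also have "\<dots> = (\<integral>p. r * (\<Sum>i\<in>UNIV. \<psi> p * (\<integral>z. S z $ i * dderiv (e_v i) A (gap r p z) \<partial>lborel)) \<partial>lborel)"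
    unfolding inner by (simp add: sum_distrib_left mult_ac)
  also have "\<dots> = r * (\<integral>p. (\<Sum>i\<in>UNIV. \<psi> p * (\<integral>z. S z $ i * dderiv (e_v i) A (gap r p z) \<partial>lborel)) \<partial>lborel)"
    by simp
  also have "(\<integral>p. (\<Sum>i\<in>UNIV. \<psi> p * (\<integral>z. S z $ i * dderiv (e_v i) A (gap r p z) \<partial>lborel)) \<partial>lborel)
    = (\<Sum>i\<in>UNIV. \<integral>p. \<psi> p * (\<integral>z. S z $ i * dderiv (e_v i) A (gap r p z) \<partial>lborel) \<partial>lborel)"
    by (intro Bochner_Integration.integral_sum gap_form_fubini(2) L2_fun_component(1)[OF S] \<psi> r
        test_fun_integrable test_fun_dderiv A)
  also have "\<dots> = (\<Sum>i\<in>UNIV. gap_form r \<psi> (\<lambda>z. S z $ i) (dderiv (e_v i) A))"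
    by (intro sum.cong refl gap_form_fubini(1)[symmetric] L2_fun_component(1)[OF S] \<psi> r
        test_fun_integrable test_fun_dderiv A)
  finally show ?thesis .
qed

text \<open>The v-derivative of \<open>B (gap r p z)\<close> carries the factor 1/r, and the weak
  gradient takes this derivative off the kernel: clearing the factor leaves r, and integration by
  parts the sign.\<close>

lemma gap_form_dderiv_v:
  assumes eq: "weak_grad_v f G" and f: "L2_fun f" and G: "L2_fun G" and \<psi>: "L2_fun \<psi>"
    and B: "test_fun B" and r: "r > 0"
  shows "gap_form r \<psi> f (dderiv (e_v i) B) = - r * gap_form r \<psi> (\<lambda>z. G z $ i) B"
proof -
  have sm: "smooth_fun B" by (rule test_fun_smooth[OF B])
  have lin: "linear (frechet_derivative B (at q))" for q
    by (rule linear_frechet_derivative[OF smooth_fun_differentiable[OF sm]])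
  have inner: "(\<integral>z. f z * dderiv (e_v i) B (gap r p z) \<partial>lborel)
      = - r * (\<integral>z. G z $ i * B (gap r p z) \<partial>lborel)" for p
  proof -
    have "(\<integral>z. f z * frechet_derivative (\<lambda>z. B (gap r p z)) (at z) (e_v i) \<partial>lborel)
      = - (\<integral>z. (G z \<bullet> axis i 1) * B (gap r p z) \<partial>lborel)"
      using eq test_fun_gap[OF B r, of p] unfolding weak_grad_v_def by blast
    moreover have "frechet_derivative (\<lambda>z. B (gap r p z)) (at z) (e_v i) = (1 / r) * dderiv (e_v i) B (gap r p z)" for z
      unfolding frechet_derivative_gap[OF sm] gap_linear_v linear_scale[OF lin] by simp
    ultimately have "(\<integral>z. (1 / r) * (f z * dderiv (e_v i) B (gap r p z)) \<partial>lborel)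
      = - (\<integral>z. G z $ i * B (gap r p z) \<partial>lborel)"
      by (simp add: inner_axis mult_ac)
    then show ?thesis using r by (simp add: field_simps)
  qed
  show ?thesis
    unfolding gap_form_fubini(1)[OF f \<psi> test_fun_integrable[OF test_fun_dderiv[OF B]] r]
      gap_form_fubini(1)[OF L2_fun_component(1)[OF G] \<psi> test_fun_integrable[OF B] r] inner
    by (subst integral_mult_right_zero[symmetric]) (simp add: mult_ac)
qed

text \<open>Once transport and v-derivatives are traded for S and G, the remaining kernels enter
  Schur's test through their L^1 norms. These depend on \<open>h\<close> alone, which makes
  \<open>C\<close> uniform in f, \<open>\<psi>\<close> and the scale.\<close>

lemma kinetic_divergence_gap_form_bound:
  fixes h :: "'n::finite phase \<Rightarrow> real"
  assumes "kinetic_divergence h"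
  obtains C where "C > 0" "\<And>f G S \<psi> r l. L2_fun f \<Longrightarrow> L2_fun G \<Longrightarrow> L2_fun S \<Longrightarrow> L2_fun \<psi> \<Longrightarrow>
    weak_grad_v f G \<Longrightarrow> kinetic_eq f S \<Longrightarrow> r > 0 \<Longrightarrow> l > 0 \<Longrightarrow>
    \<bar>gap_form r \<psi> f h\<bar> \<le> C * r ^ kdim TYPE('n) * r *
      (l * (\<integral>p. (\<psi> p)\<^sup>2 \<partial>lborel) + ((\<integral>p. (norm (G p))\<^sup>2 \<partial>lborel) + (\<integral>p. (norm (S p))\<^sup>2 \<partial>lborel)) / l)"
proof -
  obtain A B where A: "test_fun A" and B: "\<And>i. test_fun (B i)"
    and h: "\<And>q. h q = transport A q + (\<Sum>i\<in>UNIV. dderiv (e_v i) (B i) q)"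
    using assms unfolding kinetic_divergence_def by blast
  define M where "M = 1 + (\<Sum>i\<in>UNIV. (\<integral>q. \<bar>dderiv (e_v i) A q\<bar> \<partial>lborel) + (\<integral>q. \<bar>B i q\<bar> \<partial>lborel))"
  have nn: "0 \<le> (\<integral>q. \<bar>k q\<bar> \<partial>lborel)" for k :: "'n phase \<Rightarrow> real" by simp
  have M0: "M \<ge> 1" unfolding M_def by (simp add: sum_nonneg)
  have le: "(\<integral>q. \<bar>dderiv (e_v i) A q\<bar> \<partial>lborel) + (\<integral>q. \<bar>B i q\<bar> \<partial>lborel) \<le> M - 1" for i
    unfolding M_def add_diff_cancel_left' by (rule member_le_sum) auto
  have M: "(\<integral>q. \<bar>dderiv (e_v i) A q\<bar> \<partial>lborel) \<le> M" "(\<integral>q. \<bar>B i q\<bar> \<partial>lborel) \<le> M" for i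
    using le[of i] nn[of "dderiv (e_v i) A"] nn[of "B i"] by linarith+
  define C where "C = 2 * real CARD('n) * M"
  show ?thesis
  proof
    show "C > 0" using M0 by (simp add: C_def)
    fix f \<psi> :: "'n phase \<Rightarrow> real" and G S :: "'n phase \<Rightarrow> real ^ 'n" and r l :: real
    assume f: "L2_fun f" and G: "L2_fun G" and S: "L2_fun S" and \<psi>: "L2_fun \<psi>"
      and wg: "weak_grad_v f G" and ke: "kinetic_eq f S" and r: "r > 0" and l: "l > 0"
    let ?Q = "r ^ kdim TYPE('n)" and ?P = "l * (\<integral>p. (\<psi> p)\<^sup>2 \<partial>lborel)"
    let ?s = "\<lambda>i. \<integral>z. (S z $ i)\<^sup>2 \<partial>lborel" and ?g = "\<lambda>i. \<integral>z. (G z $ i)\<^sup>2 \<partial>lborel"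
    have hq: "h = (\<lambda>q. transport A q + (\<Sum>i\<in>UNIV. dderiv (e_v i) (B i) q))" using h by blast
    have "gap_form r \<psi> f h = gap_form r \<psi> f (transport A) + (\<Sum>i\<in>UNIV. gap_form r \<psi> f (dderiv (e_v i) (B i)))"
      unfolding hq using A B r f \<psi>
      by (simp add: gap_form_add gap_form_sum test_fun_integrable test_fun_transport test_fun_dderiv test_fun_sum)
    also have "\<dots> = r * (\<Sum>i\<in>UNIV. gap_form r \<psi> (\<lambda>z. S z $ i) (dderiv (e_v i) A) - gap_form r \<psi> (\<lambda>z. G z $ i) (B i))"
      unfolding gap_form_transport[OF ke f S \<psi> A r] gap_form_dderiv_v[OF wg f G \<psi> B r]
      by (simp add: sum_subtractf sum_distrib_left[symmetric] sum_negf right_diff_distrib)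
    finally have "\<bar>gap_form r \<psi> f h\<bar> = r * \<bar>\<Sum>i\<in>UNIV. gap_form r \<psi> (\<lambda>z. S z $ i) (dderiv (e_v i) A) - gap_form r \<psi> (\<lambda>z. G z $ i) (B i)\<bar>"
      using r by (simp add: abs_mult)
    also have "\<dots> \<le> r * (\<Sum>i\<in>UNIV. ?Q * M * (?P + ?s i / l) + ?Q * M * (?P + ?g i / l))"
    proof (intro mult_left_mono order_trans[OF sum_abs] sum_mono)
      fix i
      have P0: "0 \<le> ?P + ?s i / l" "0 \<le> ?P + ?g i / l" using l by simp_all
      have "\<bar>gap_form r \<psi> (\<lambda>z. S z $ i) (dderiv (e_v i) A)\<bar> \<le> ?Q * (\<integral>q. \<bar>dderiv (e_v i) A q\<bar> \<partial>lborel) * (?P + ?s i / l)"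
        unfolding gap_form_def
        by (rule gap_form_bound(2)[OF L2_fun_component(1)[OF S] \<psi> test_fun_integrable[OF test_fun_dderiv[OF A]] r l])
      also have "\<dots> \<le> ?Q * M * (?P + ?s i / l)"
        using M(1) P0(1) r by (intro mult_right_mono mult_left_mono) auto
      finally have 1: "\<bar>gap_form r \<psi> (\<lambda>z. S z $ i) (dderiv (e_v i) A)\<bar> \<le> ?Q * M * (?P + ?s i / l)" .
      have "\<bar>gap_form r \<psi> (\<lambda>z. G z $ i) (B i)\<bar> \<le> ?Q * (\<integral>q. \<bar>B i q\<bar> \<partial>lborel) * (?P + ?g i / l)"
        unfolding gap_form_def
        by (rule gap_form_bound(2)[OF L2_fun_component(1)[OF G] \<psi> test_fun_integrable[OF B] r l])
      also have "\<dots> \<le> ?Q * M * (?P + ?g i / l)"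
        using M(2) P0(2) r by (intro mult_right_mono mult_left_mono) auto
      finally have 2: "\<bar>gap_form r \<psi> (\<lambda>z. G z $ i) (B i)\<bar> \<le> ?Q * M * (?P + ?g i / l)" .
      show "\<bar>gap_form r \<psi> (\<lambda>z. S z $ i) (dderiv (e_v i) A) - gap_form r \<psi> (\<lambda>z. G z $ i) (B i)\<bar>
        \<le> ?Q * M * (?P + ?s i / l) + ?Q * M * (?P + ?g i / l)"
        using 1 2 by linarith
    qed (use r in simp)
    also have "\<dots> = r * ?Q * M * (2 * real CARD('n) * ?P + ((\<Sum>i\<in>UNIV. ?g i) + (\<Sum>i\<in>UNIV. ?s i)) / l)"
      by (simp add: sum.distrib sum_distrib_left[symmetric] sum_divide_distrib[symmetric] add_divide_distrib algebra_simps)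
    also have "\<dots> = r * ?Q * M * (2 * real CARD('n) * ?P + ((\<integral>p. (norm (G p))\<^sup>2 \<partial>lborel) + (\<integral>p. (norm (S p))\<^sup>2 \<partial>lborel)) / l)"
      unfolding L2_fun_component(2)[OF G] L2_fun_component(2)[OF S] ..
    \<comment> \<open>The term with \<open>\<psi>\<close> occurs once for each of the 2n components,
      whereas the component norms add up without a factor. Enlarging the latter gives both terms one
      common constant.\<close>
    also have "\<dots> \<le> r * ?Q * M * (2 * real CARD('n) * ?P + 2 * real CARD('n) * (((\<integral>p. (norm (G p))\<^sup>2 \<partial>lborel) + (\<integral>p. (norm (S p))\<^sup>2 \<partial>lborel)) / l))"
    proof (intro mult_left_mono add_left_mono)
      have "1 \<le> 2 * real CARD('n)" using zero_less_card_finite[where 'a = 'n] by linarith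
      moreover have "0 \<le> ((\<integral>p. (norm (G p))\<^sup>2 \<partial>lborel) + (\<integral>p. (norm (S p))\<^sup>2 \<partial>lborel)) / l" using l by simp
      ultimately show "((\<integral>p. (norm (G p))\<^sup>2 \<partial>lborel) + (\<integral>p. (norm (S p))\<^sup>2 \<partial>lborel)) / l
        \<le> 2 * real CARD('n) * (((\<integral>p. (norm (G p))\<^sup>2 \<partial>lborel) + (\<integral>p. (norm (S p))\<^sup>2 \<partial>lborel)) / l)"
        using mult_right_mono by fastforce
    qed (use r M0 in simp)
    also have "\<dots> = C * ?Q * r *
      (l * (\<integral>p. (\<psi> p)\<^sup>2 \<partial>lborel) + ((\<integral>p. (norm (G p))\<^sup>2 \<partial>lborel) + (\<integral>p. (norm (S p))\<^sup>2 \<partial>lborel)) / l)"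
      unfolding C_def distrib_left[symmetric] by (simp only: mult_ac)
    finally show "\<bar>gap_form r \<psi> f h\<bar> \<le> C * ?Q * r *
      (l * (\<integral>p. (\<psi> p)\<^sup>2 \<partial>lborel) + ((\<integral>p. (norm (G p))\<^sup>2 \<partial>lborel) + (\<integral>p. (norm (S p))\<^sup>2 \<partial>lborel)) / l)" .
  qed
qed

subsection \<open>Dyadic scales\<close>

text \<open>Identifies the second kernel of the dyadic difference with the first one at half the
  scale.\<close>

lemma dilate_gap: "r > 0 \<Longrightarrow> dilate 2 (gap r p z) = gap (r / 2) p z"
  by (cases p; cases z) (simp add: gap_def dilate_def power_divide inverse_eq_divide)

lemma kdiv_tendsto:
  assumes "\<rho> \<longlonglongrightarrow> 0"
  shows "(\<lambda>k. kdiv (\<rho> k) z q) \<longlonglongrightarrow> z"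
proof -
  obtain \<tau> \<xi> \<eta> where z: "z = (\<tau>, \<xi>, \<eta>)" by (cases z)
  obtain s y w where q: "q = (s, y, w)" by (cases q)
  have "(\<lambda>k. kdiv (\<rho> k) z q) \<longlonglongrightarrow> (\<tau> + (- (0 ^ 2)) * s,
      \<xi> - (0 ^ 2 * s) *\<^sub>R (\<eta> - 0 *\<^sub>R w) + (- (0 ^ 3)) *\<^sub>R y, \<eta> + (- 0) *\<^sub>R w)"
    unfolding z q kdiv_def prod.case by (intro tendsto_intros assms)
  then show ?thesis by (simp add: z)
qed

lemma kdiv_borel: "kdiv r z \<in> borel_measurable borel"
proof -
  have "continuous_on UNIV (kdiv r z)"
    by (cases z) (simp add: kdiv_def split_beta, intro continuous_intros)
  then show ?thesis by (rule borel_measurable_continuous_onI)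
qed

text \<open>The nonnegative change of variables, applied to indicators, is an identity of measures;
  in this form it transfers to signed functions.\<close>

lemma integral_kdiv:
  fixes F :: "'n::finite phase \<Rightarrow> real"
  assumes [measurable]: "F \<in> borel_measurable borel" and r: "r > 0"
  shows "(\<integral>p. F p \<partial>lborel) = r ^ kdim TYPE('n) * (\<integral>q. F (kdiv r z q) \<partial>lborel)"
proof -
  note [measurable] = kdiv_borel
  let ?c = "r ^ kdim TYPE('n)"
  have "lborel = density (distr lborel borel (kdiv r z)) (\<lambda>_. ennreal ?c)" (is "_ = ?D")
  proof (rule measure_eqI)
    fix A :: "'n phase set" assume "A \<in> sets lborel"
    then have [measurable]: "A \<in> sets borel" by simp
    have "emeasure lborel A = (\<integral>\<^sup>+p. indicator A p \<partial>lborel)" by simp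
    also have "\<dots> = ennreal ?c * (\<integral>\<^sup>+q. indicator A (kdiv r z q) \<partial>lborel)"
      by (rule nn_integral_kdiv[OF _ r]) simp
    also have "\<dots> = ennreal ?c * (\<integral>\<^sup>+q. indicator A q \<partial>(distr lborel borel (kdiv r z)))"
      by (subst nn_integral_distr) simp_all
    also have "\<dots> = emeasure ?D A"
      by (simp add: emeasure_density nn_integral_cmult)
    finally show "emeasure lborel A = emeasure ?D A" .
  qed simp
  then have "(\<integral>p. F p \<partial>lborel) = integral\<^sup>L ?D F" by simp
  also have "\<dots> = (\<integral>p. ?c * F p \<partial>(distr lborel borel (kdiv r z)))"
    using r by (subst integral_density) simp_all
  also have "\<dots> = ?c * (\<integral>q. F (kdiv r z q) \<partial>lborel)"
    by (simp add: integral_distr)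
  finally show ?thesis .
qed

text \<open>The class of dual functions. No derivative ever falls on \<open>\<psi>\<close>, and
  truncations of continuous functions stay in this class, which is how f itself will be
  approached.\<close>

definition Cc :: "('a::euclidean_space \<Rightarrow> real) \<Rightarrow> bool" where
  "Cc \<psi> \<longleftrightarrow> continuous_on UNIV \<psi> \<and> (\<exists>R. \<forall>p. \<psi> p \<noteq> 0 \<longrightarrow> norm p \<le> R)"

lemma Cc_bounded:
  assumes "Cc \<psi>" obtains M where "M > 0" "\<And>p. \<bar>\<psi> p\<bar> \<le> M"
proof -
  obtain R where R: "\<And>p. \<psi> p \<noteq> 0 \<Longrightarrow> norm p \<le> R" using assms unfolding Cc_def by blast
  have "bounded (\<psi> ` cball 0 R)"
    using assms unfolding Cc_def
    by (intro compact_imp_bounded compact_continuous_image) (auto intro: continuous_on_subset)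
  then obtain M where M: "M > 0" "\<forall>x\<in>\<psi> ` cball 0 R. \<bar>x\<bar> \<le> M"
    unfolding bounded_pos real_norm_def by blast
  have "\<bar>\<psi> p\<bar> \<le> M" for p
    using M R[of p] by (cases "\<psi> p = 0") auto
  then show ?thesis using M that by blast
qed

lemma Cc_borel: "Cc \<psi> \<Longrightarrow> \<psi> \<in> borel_measurable borel"
  unfolding Cc_def by (blast intro: borel_measurable_continuous_onI)

lemma Cc_integrable:
  assumes "Cc \<psi>" shows "integrable lborel \<psi>"
proof -
  obtain M where M: "M > 0" "\<And>p. \<bar>\<psi> p\<bar> \<le> M" using Cc_bounded[OF assms] by metis
  obtain R where R: "\<And>p. \<psi> p \<noteq> 0 \<Longrightarrow> norm p \<le> R" using assms unfolding Cc_def by blast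
  show ?thesis
  proof (rule Bochner_Integration.integrable_bound)
    show "integrable lborel (\<lambda>p. M * indicator (cball 0 R) p)"
      using emeasure_lborel_cball_finite by (intro integrable_mult_right integrable_real_indicator) auto
    have "norm (\<psi> p) \<le> norm (M * indicator (cball 0 R) p)" for p
      using M R[of p] by (cases "\<psi> p = 0") auto
    then show "AE p in lborel. norm (\<psi> p) \<le> norm (M * indicator (cball 0 R) p)"
      by simp
  qed (use Cc_borel[OF assms] in simp)
qed

lemma Cc_L2: assumes "Cc \<psi>" shows "L2_fun \<psi>"
proof -
  have "Cc (\<lambda>p. (\<psi> p)\<^sup>2)"
    using assms unfolding Cc_def by (auto intro!: continuous_intros)
  from Cc_integrable[OF this] Cc_borel[OF assms] show ?thesis by (simp add: L2_fun_real)
qed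

text \<open>The average is moved from f to \<open>\<psi>\<close>, where convergence is pointwise:
  \<open>kdiv (\<rho> k) z q\<close> tends to z and \<open>\<psi>\<close> is continuous. Boundedness
  of \<open>\<psi>\<close> and integrability of \<open>K\<close> and \<open>f\<close> dominate the
  inner and the outer integral.\<close>

lemma gap_form_tendsto:
  fixes f \<psi> K :: "'n::finite phase \<Rightarrow> real"
  assumes f: "L2_fun f" "integrable lborel f" and \<psi>: "Cc \<psi>" and K: "integrable lborel K" "integral\<^sup>L lborel K = 1"
    and \<rho>: "\<And>k. \<rho> k > 0" "\<rho> \<longlonglongrightarrow> 0"
  shows "(\<lambda>k. gap_form (\<rho> k) \<psi> f K / \<rho> k ^ kdim TYPE('n)) \<longlonglongrightarrow> (\<integral>z. f z * \<psi> z \<partial>lborel)"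
proof -
  note [measurable] = kdiv_borel Cc_borel[OF \<psi>]
  have [measurable]: "K \<in> borel_measurable borel" "f \<in> borel_measurable borel"
    using borel_measurable_integrable K(1) f(2) by auto
  obtain M where M: "M > 0" "\<And>p. \<bar>\<psi> p\<bar> \<le> M" using Cc_bounded[OF \<psi>] by metis
  have Mb: "norm (\<psi> x * K q) \<le> M * \<bar>K q\<bar>" for x q
    using mult_right_mono[OF M(2) abs_ge_zero] by (simp add: abs_mult)
  define I where "I k z = (\<integral>q. \<psi> (kdiv (\<rho> k) z q) * K q \<partial>lborel)" for k z
  have eq: "(\<integral>p. \<psi> p * K (gap (\<rho> k) p z) \<partial>lborel) = \<rho> k ^ kdim TYPE('n) * I k z" for k z
    unfolding I_def by (subst integral_kdiv[OF _ \<rho>(1), of _ k z]) (simp_all add: gap_kdiv[OF \<rho>(1)])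
  have J: "gap_form (\<rho> k) \<psi> f K / \<rho> k ^ kdim TYPE('n) = (\<integral>z. f z * I k z \<partial>lborel)" for k
  proof -
    have "gap_form (\<rho> k) \<psi> f K = (\<integral>z. \<rho> k ^ kdim TYPE('n) * (f z * I k z) \<partial>lborel)"
      unfolding gap_form_fubini(3)[OF f(1) Cc_L2[OF \<psi>] K(1) \<rho>(1)] eq by (simp add: mult_ac)
    then show ?thesis using \<rho>(1)[of k] by simp
  qed
  have Im [measurable]: "I k \<in> borel_measurable borel" for k
  proof -
    have "(\<lambda>z. \<integral>p. \<psi> p * K (gap (\<rho> k) p z) \<partial>lborel) \<in> borel_measurable borel"
      by measurable
    then have "(\<lambda>z. (\<rho> k ^ kdim TYPE('n) * I k z) / \<rho> k ^ kdim TYPE('n)) \<in> borel_measurable borel"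
      unfolding eq by measurable
    then show ?thesis using \<rho>(1)[of k] by simp
  qed
  have Ilim: "(\<lambda>k. I k z) \<longlonglongrightarrow> \<psi> z" for z
  proof -
    have "(\<lambda>k. I k z) \<longlonglongrightarrow> (\<integral>q. \<psi> z * K q \<partial>lborel)"
      unfolding I_def
    proof (rule integral_dominated_convergence[where w = "\<lambda>q. M * \<bar>K q\<bar>"])
      have "isCont \<psi> z" using \<psi> continuous_on_eq_continuous_at[OF open_UNIV, of \<psi>] unfolding Cc_def by blast
      then have "(\<lambda>k. \<psi> (kdiv (\<rho> k) z q) * K q) \<longlonglongrightarrow> \<psi> z * K q" for q
        by (intro tendsto_intros isCont_tendsto_compose[OF _ kdiv_tendsto[OF \<rho>(2)]])
      then show "AE q in lborel. (\<lambda>k. \<psi> (kdiv (\<rho> k) z q) * K q) \<longlonglongrightarrow> \<psi> z * K q" by simp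
      show "AE q in lborel. norm (\<psi> (kdiv (\<rho> k) z q) * K q) \<le> M * \<bar>K q\<bar>" for k
        by (intro AE_I2 Mb)
    qed (use K(1) in auto)
    then show ?thesis by (simp add: K(2))
  qed
  have Ib: "\<bar>I k z\<bar> \<le> M * (\<integral>q. \<bar>K q\<bar> \<partial>lborel)" for k z
  proof -
    have "\<bar>I k z\<bar> \<le> (\<integral>q. \<bar>\<psi> (kdiv (\<rho> k) z q) * K q\<bar> \<partial>lborel)"
      unfolding I_def by (rule integral_abs_bound)
    also have "\<dots> \<le> (\<integral>q. M * \<bar>K q\<bar> \<partial>lborel)"
    proof (rule integral_mono_AE')
      show "integrable lborel (\<lambda>q. M * \<bar>K q\<bar>)" using K(1) by simp
      show "AE q in lborel. \<bar>\<psi> (kdiv (\<rho> k) z q) * K q\<bar> \<le> M * \<bar>K q\<bar>"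
        by (rule AE_I2) (rule Mb[unfolded real_norm_def])
    qed (use M(1) in simp)
    finally show ?thesis by simp
  qed
  show ?thesis unfolding J
  proof (rule integral_dominated_convergence[where w = "\<lambda>z. \<bar>f z\<bar> * (M * (\<integral>q. \<bar>K q\<bar> \<partial>lborel))"])
    show "AE z in lborel. (\<lambda>k. f z * I k z) \<longlonglongrightarrow> f z * \<psi> z"
      by (intro AE_I2 tendsto_mult_left Ilim)
    show "AE z in lborel. norm (f z * I k z) \<le> \<bar>f z\<bar> * (M * (\<integral>q. \<bar>K q\<bar> \<partial>lborel))" for k
      unfolding real_norm_def abs_mult by (intro AE_I2 mult_left_mono Ib abs_ge_zero)
  qed (use f(2) in auto)
qed

text \<open>Used at the coarsest scale only: with the kernel bounded by \<open>M\<close> the double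
  integral decouples, and normalisation by r^-Q gives the L^1 term of the estimate.\<close>

lemma gap_form_sup_bound:
  fixes f \<psi> K :: "'n::finite phase \<Rightarrow> real"
  assumes f: "L2_fun f" "integrable lborel f" and \<psi>: "Cc \<psi>" and K: "integrable lborel K"
    and M: "\<And>q. \<bar>K q\<bar> \<le> M" and r: "r > 0"
  shows "\<bar>gap_form r \<psi> f K\<bar> \<le> M * (\<integral>z. \<bar>f z\<bar> \<partial>lborel) * (\<integral>p. \<bar>\<psi> p\<bar> \<partial>lborel)"
proof -
  have M0: "0 \<le> M" using order_trans[OF abs_ge_zero M] .
  have 1: "\<bar>\<integral>z. f z * K (gap r p z) \<partial>lborel\<bar> \<le> M * (\<integral>z. \<bar>f z\<bar> \<partial>lborel)" for p
  proof -
    have "\<bar>\<integral>z. f z * K (gap r p z) \<partial>lborel\<bar> \<le> (\<integral>z. \<bar>f z * K (gap r p z)\<bar> \<partial>lborel)"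
      by (rule integral_abs_bound)
    also have "\<dots> \<le> (\<integral>z. M * \<bar>f z\<bar> \<partial>lborel)"
    proof (rule integral_mono_AE')
      show "integrable lborel (\<lambda>z. M * \<bar>f z\<bar>)" using f(2) by simp
      show "AE z in lborel. \<bar>f z * K (gap r p z)\<bar> \<le> M * \<bar>f z\<bar>"
        using mult_right_mono[OF M abs_ge_zero] by (intro AE_I2) (simp add: abs_mult mult.commute)
    qed (use M0 in simp)
    finally show ?thesis by simp
  qed
  have "\<bar>gap_form r \<psi> f K\<bar> \<le> (\<integral>p. \<bar>\<psi> p * (\<integral>z. f z * K (gap r p z) \<partial>lborel)\<bar> \<partial>lborel)"
    unfolding gap_form_fubini(1)[OF f(1) Cc_L2[OF \<psi>] K r] by (rule integral_abs_bound)
  also have "\<dots> \<le> (\<integral>p. (M * (\<integral>z. \<bar>f z\<bar> \<partial>lborel)) * \<bar>\<psi> p\<bar> \<partial>lborel)"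
  proof (rule integral_mono_AE')
    show "integrable lborel (\<lambda>p. (M * (\<integral>z. \<bar>f z\<bar> \<partial>lborel)) * \<bar>\<psi> p\<bar>)"
      using Cc_integrable[OF \<psi>] by simp
    show "AE p in lborel. \<bar>\<psi> p * (\<integral>z. f z * K (gap r p z) \<partial>lborel)\<bar> \<le> (M * (\<integral>z. \<bar>f z\<bar> \<partial>lborel)) * \<bar>\<psi> p\<bar>"
      using mult_right_mono[OF 1 abs_ge_zero] by (intro AE_I2) (simp add: abs_mult mult.commute)
  qed (use M0 in simp)
  finally show ?thesis by simp
qed

lemma dyadic_telescope:
  fixes J :: "nat \<Rightarrow> real"
  assumes "\<And>k. \<bar>J k - J (Suc k)\<bar> \<le> E / 2 ^ k"
  shows "\<bar>J 0 - J k\<bar> \<le> 2 * E"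
proof -
  \<comment> \<open>The exact partial sum of the geometric series; the bound \<open>2 * E\<close> by
    itself would not be inductive.\<close>
  have "\<bar>J 0 - J k\<bar> \<le> 2 * E - 2 * E / 2 ^ k"
  proof (induction k)
    case (Suc k)
    have "\<bar>J 0 - J (Suc k)\<bar> \<le> \<bar>J 0 - J k\<bar> + \<bar>J k - J (Suc k)\<bar>" by simp
    also have "\<dots> \<le> (2 * E - 2 * E / 2 ^ k) + E / 2 ^ k" by (intro add_mono Suc assms)
    also have "\<dots> = 2 * E - 2 * E / 2 ^ Suc k" by (simp add: field_simps)
    finally show ?case .
  qed simp
  moreover have "0 \<le> E" using assms[of 0] by simp
  then have "0 \<le> 2 * E / 2 ^ k" by simp
  ultimately show ?thesis by linarith
qed

text \<open>The normalised pairings \<open>J k\<close> at scales \<open>r / 2 ^ k\<close> start from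
  a value controlled by L^1 norms and tend to the integral of f \<psi>, with increments decaying
  geometrically. All constants come from the kernel, hence depend on n only.\<close>

lemma kinetic_test_inequality:
  obtains C where "C > 0"
    "\<And>(f :: 'n::finite phase \<Rightarrow> real) G S \<psi> r l. L2_fun f \<Longrightarrow> integrable lborel f \<Longrightarrow> L2_fun G \<Longrightarrow> L2_fun S \<Longrightarrow>
      weak_grad_v f G \<Longrightarrow> kinetic_eq f S \<Longrightarrow> Cc \<psi> \<Longrightarrow> r > 0 \<Longrightarrow> l > 0 \<Longrightarrow>
      (\<integral>z. f z * \<psi> z \<partial>lborel) \<le> C * (r * (l * (\<integral>p. (\<psi> p)\<^sup>2 \<partial>lborel)
          + ((\<integral>p. (norm (G p))\<^sup>2 \<partial>lborel) + (\<integral>p. (norm (S p))\<^sup>2 \<partial>lborel)) / l)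
        + (\<integral>z. \<bar>f z\<bar> \<partial>lborel) * (\<integral>p. \<bar>\<psi> p\<bar> \<partial>lborel) / r ^ kdim TYPE('n))"
proof -
  let ?Q = "kdim TYPE('n)"
  obtain K :: "'n phase \<Rightarrow> real" where K: "test_fun K" "integral\<^sup>L lborel K = 1"
    and kd: "kinetic_divergence (\<lambda>q. K q - 2 ^ ?Q * K (dilate 2 q))"
    by (rule dyadic_kernel_exists) (rule that)
  define h where "h = (\<lambda>q. K q - 2 ^ ?Q * K (dilate 2 q))"
  have kdh: "kinetic_divergence h" using kd by (simp only: h_def)
  obtain C where C: "C > 0" and bound: "\<And>f G S \<psi> r l. L2_fun f \<Longrightarrow> L2_fun G \<Longrightarrow> L2_fun S \<Longrightarrow> L2_fun \<psi> \<Longrightarrow>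
    weak_grad_v f G \<Longrightarrow> kinetic_eq f S \<Longrightarrow> r > 0 \<Longrightarrow> l > 0 \<Longrightarrow>
    \<bar>gap_form r \<psi> f h\<bar> \<le> C * r ^ ?Q * r *
      (l * (\<integral>p. (\<psi> p)\<^sup>2 \<partial>lborel) + ((\<integral>p. (norm (G p))\<^sup>2 \<partial>lborel) + (\<integral>p. (norm (S p))\<^sup>2 \<partial>lborel)) / l)"
    by (rule kinetic_divergence_gap_form_bound[OF kdh]) (rule that)
  obtain M where M: "M > 0" "\<And>q. \<bar>K q\<bar> \<le> M" using test_fun_bounded[OF K(1)] by metis
  have intK: "integrable lborel K" by (rule test_fun_integrable[OF K(1)])
  show ?thesis
  proof
    \<comment> \<open>\<open>2 * C\<close> comes from the geometric series, \<open>M\<close> from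
      the coarsest scale.\<close>
    show "2 * C + M > 0" using C M by simp
    fix f \<psi> :: "'n phase \<Rightarrow> real" and G S :: "'n phase \<Rightarrow> real ^ 'n" and r l :: real
    assume f: "L2_fun f" "integrable lborel f" and G: "L2_fun G" and S: "L2_fun S" and \<psi>: "Cc \<psi>"
      and wg: "weak_grad_v f G" and ke: "kinetic_eq f S" and r: "r > 0" and l: "l > 0"
    let ?E = "l * (\<integral>p. (\<psi> p)\<^sup>2 \<partial>lborel) + ((\<integral>p. (norm (G p))\<^sup>2 \<partial>lborel) + (\<integral>p. (norm (S p))\<^sup>2 \<partial>lborel)) / l"
    let ?A = "(\<integral>z. \<bar>f z\<bar> \<partial>lborel) * (\<integral>p. \<bar>\<psi> p\<bar> \<partial>lborel)"
    have E0: "?E \<ge> 0" using l by simp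
    have A0: "?A \<ge> 0" by simp
    define \<rho> where "\<rho> k = r / 2 ^ k" for k
    have \<rho>: "\<rho> k > 0" for k using r by (simp add: \<rho>_def)
    define J where "J k = gap_form (\<rho> k) \<psi> f K / \<rho> k ^ ?Q" for k
    have "\<bar>J k - J (Suc k)\<bar> \<le> (C * r * ?E) / 2 ^ k" for k
    proof -
      have gap2: "K (dilate 2 (gap (\<rho> k) p z)) = K (gap (\<rho> (Suc k)) p z)" for p z
        using dilate_gap[OF \<rho>, of k p z] by (simp add: \<rho>_def mult.commute)
      have scaled: "gap_form (\<rho> k) \<psi> f (\<lambda>q. K (dilate 2 q)) = gap_form (\<rho> (Suc k)) \<psi> f K"
        unfolding gap_form_def gap2 ..
      have "gap_form (\<rho> k) \<psi> f h = integral\<^sup>L lborel (\<lambda>x.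
          (case x of (p, z) \<Rightarrow> \<psi> p * (f z * K (gap (\<rho> k) p z)))
          - 2 ^ ?Q * (case x of (p, z) \<Rightarrow> \<psi> p * (f z * K (gap (\<rho> (Suc k)) p z))))"
        unfolding gap_form_def h_def gap2 by (simp add: case_prod_unfold algebra_simps)
      also have "\<dots> = gap_form (\<rho> k) \<psi> f K - 2 ^ ?Q * gap_form (\<rho> (Suc k)) \<psi> f K"
        unfolding gap_form_def
        using gap_form_bound(1)[OF f(1) Cc_L2[OF \<psi>] intK \<rho> zero_less_one]
        by (subst Bochner_Integration.integral_diff) auto
      finally have "gap_form (\<rho> k) \<psi> f h = gap_form (\<rho> k) \<psi> f K - 2 ^ ?Q * gap_form (\<rho> (Suc k)) \<psi> f K" .
      \<comment> \<open>The weight of the dilated kernel in \<open>h\<close> is the ratio of the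
        normalisations at two consecutive scales, so dividing by the first one yields exactly the
        increment of \<open>J\<close>.\<close>
      moreover have "\<rho> k ^ ?Q = 2 ^ ?Q * \<rho> (Suc k) ^ ?Q"
        by (simp add: \<rho>_def power_mult_distrib[symmetric])
      ultimately have "J k - J (Suc k) = gap_form (\<rho> k) \<psi> f h / \<rho> k ^ ?Q"
        using \<rho>[of "Suc k"] by (simp add: J_def diff_divide_distrib)
      also have "\<bar>\<dots>\<bar> = \<bar>gap_form (\<rho> k) \<psi> f h\<bar> / \<rho> k ^ ?Q"
        using \<rho>[of k] by simp
      also have "\<dots> \<le> (C * \<rho> k ^ ?Q * \<rho> k * ?E) / \<rho> k ^ ?Q"
        using \<rho>[of k] by (intro divide_right_mono bound[OF f(1) G S Cc_L2[OF \<psi>] wg ke \<rho> l]) simp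
      also have "\<dots> = C * \<rho> k * ?E" using \<rho>[of k] by simp
      finally show ?thesis by (simp add: \<rho>_def)
    qed
    then have tel: "\<bar>J 0 - J k\<bar> \<le> 2 * (C * r * ?E)" for k by (rule dyadic_telescope)
    have "\<rho> \<longlonglongrightarrow> 0"
      unfolding \<rho>_def using LIMSEQ_divide_realpow_zero[of 2 r] by simp
    from gap_form_tendsto[OF f \<psi> intK K(2) \<rho> this]
    have lim: "J \<longlonglongrightarrow> (\<integral>z. f z * \<psi> z \<partial>lborel)" unfolding J_def[abs_def] .
    have "J 0 \<le> M * (?A / r ^ ?Q)"
    proof -
      have "J 0 \<le> (M * (\<integral>z. \<bar>f z\<bar> \<partial>lborel) * (\<integral>p. \<bar>\<psi> p\<bar> \<partial>lborel)) / r ^ ?Q"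
        unfolding J_def using gap_form_sup_bound[OF f \<psi> intK M(2) \<rho>, of 0] r
        by (simp add: \<rho>_def divide_right_mono)
      then show ?thesis by (simp add: mult.assoc)
    qed
    then have "J k \<le> 2 * (C * r * ?E) + M * (?A / r ^ ?Q)" for k
      using tel[of k] by linarith
    with lim have "(\<integral>z. f z * \<psi> z \<partial>lborel) \<le> 2 * (C * r * ?E) + M * (?A / r ^ ?Q)"
      by (intro LIMSEQ_le_const2) auto
    also have "\<dots> \<le> (2 * C + M) * (r * ?E + ?A / r ^ ?Q)"
    proof -
      have "2 * (C * r * X) + M * Y \<le> (2 * C + M) * (r * X + Y)" if "0 \<le> X" "0 \<le> Y" for X Y
      proof -
        have "0 \<le> M * (r * X)" "0 \<le> C * Y" using M C r that by simp_all
        then show ?thesis by (simp add: algebra_simps)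
      qed
      moreover have "0 \<le> ?A / r ^ ?Q" using A0 r by (intro divide_nonneg_nonneg) auto
      ultimately show ?thesis using E0 by blast
    qed
    finally show "(\<integral>z. f z * \<psi> z \<partial>lborel) \<le> (2 * C + M) * (r * ?E + ?A / r ^ ?Q)" .
  qed
qed

subsection \<open>Density and optimisation\<close>

text \<open>Dominated convergence in each of the three integrals; needed both for continuous
  approximations and for removing the truncation.\<close>

lemma quadratic_inequality_limit:
  fixes f \<phi> w :: "'a::euclidean_space \<Rightarrow> real"
  assumes meas [measurable]: "f \<in> borel_measurable borel" "\<phi> \<in> borel_measurable borel"
      "\<And>n. \<psi> n \<in> borel_measurable borel"
    and lim: "AE p in lborel. (\<lambda>n. \<psi> n p) \<longlonglongrightarrow> \<phi> p"
    and bound: "\<And>n p. \<bar>\<psi> n p\<bar> \<le> w p"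
    and w: "integrable lborel w" "integrable lborel (\<lambda>p. (w p)\<^sup>2)" "integrable lborel (\<lambda>p. \<bar>f p\<bar> * w p)"
    and ineq: "\<And>n. (\<integral>p. f p * \<psi> n p \<partial>lborel) \<le> a * (\<integral>p. (\<psi> n p)\<^sup>2 \<partial>lborel) + b * (\<integral>p. \<bar>\<psi> n p\<bar> \<partial>lborel) + c"
  shows "(\<integral>p. f p * \<phi> p \<partial>lborel) \<le> a * (\<integral>p. (\<phi> p)\<^sup>2 \<partial>lborel) + b * (\<integral>p. \<bar>\<phi> p\<bar> \<partial>lborel) + c"
proof (rule LIMSEQ_le)
  have bound2: "(\<psi> n p)\<^sup>2 \<le> (w p)\<^sup>2" for n p
    using bound[of n p] by (rule power2_le_iff_abs_le[THEN iffD2, rotated]) (use order_trans[OF abs_ge_zero bound] in blast)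
  show "(\<lambda>n. \<integral>p. f p * \<psi> n p \<partial>lborel) \<longlonglongrightarrow> (\<integral>p. f p * \<phi> p \<partial>lborel)"
  proof (rule integral_dominated_convergence[where w = "\<lambda>p. \<bar>f p\<bar> * w p"])
    show "AE p in lborel. (\<lambda>n. f p * \<psi> n p) \<longlonglongrightarrow> f p * \<phi> p"
      using lim by eventually_elim (rule tendsto_mult_left)
    show "AE p in lborel. norm (f p * \<psi> n p) \<le> \<bar>f p\<bar> * w p" for n
      unfolding real_norm_def abs_mult by (intro AE_I2 mult_left_mono bound abs_ge_zero)
  qed (use w in auto)
  have 1: "(\<lambda>n. \<integral>p. (\<psi> n p)\<^sup>2 \<partial>lborel) \<longlonglongrightarrow> (\<integral>p. (\<phi> p)\<^sup>2 \<partial>lborel)"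
  proof (rule integral_dominated_convergence[where w = "\<lambda>p. (w p)\<^sup>2"])
    show "AE p in lborel. (\<lambda>n. (\<psi> n p)\<^sup>2) \<longlonglongrightarrow> (\<phi> p)\<^sup>2"
      using lim by eventually_elim (rule tendsto_power)
    show "AE p in lborel. norm ((\<psi> n p)\<^sup>2) \<le> (w p)\<^sup>2" for n
      using bound2 by simp
  qed (use w in auto)
  have 2: "(\<lambda>n. \<integral>p. \<bar>\<psi> n p\<bar> \<partial>lborel) \<longlonglongrightarrow> (\<integral>p. \<bar>\<phi> p\<bar> \<partial>lborel)"
  proof (rule integral_dominated_convergence[where w = w])
    show "AE p in lborel. (\<lambda>n. \<bar>\<psi> n p\<bar>) \<longlonglongrightarrow> \<bar>\<phi> p\<bar>"
      using lim by eventually_elim (rule tendsto_rabs)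
    show "AE p in lborel. norm \<bar>\<psi> n p\<bar> \<le> w p" for n
      using bound by simp
  qed (use w in auto)
  show "(\<lambda>n. a * (\<integral>p. (\<psi> n p)\<^sup>2 \<partial>lborel) + b * (\<integral>p. \<bar>\<psi> n p\<bar> \<partial>lborel) + c) \<longlonglongrightarrow>
      a * (\<integral>p. (\<phi> p)\<^sup>2 \<partial>lborel) + b * (\<integral>p. \<bar>\<phi> p\<bar> \<partial>lborel) + c"
    by (intro tendsto_intros 1 2)
qed (use ineq in blast)

text \<open>\<open>measurable_on\<close> means being a limit of continuous functions off a
  negligible set, so the approximation is read off from Lebesgue measurability.\<close>

lemma borel_AE_limit_continuous:
  fixes f :: "'a::euclidean_space \<Rightarrow> real"
  assumes "f \<in> borel_measurable borel"
  obtains g where "\<And>n. continuous_on UNIV (g n)" "AE x in lborel. (\<lambda>n::nat. g n x) \<longlonglongrightarrow> f x"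
proof -
  have "f \<in> borel_measurable lebesgue" using assms by (intro measurable_completion) simp
  then have "f measurable_on UNIV" by (rule lebesgue_measurable_imp_measurable_on) simp
  then obtain N g where N: "negligible N" and g: "\<And>n. continuous_on UNIV (g n)"
    and lim: "\<And>x. x \<notin> N \<Longrightarrow> (\<lambda>n::nat. g n x) \<longlonglongrightarrow> f x"
    unfolding measurable_on_def by auto
  have "AE x in lebesgue. x \<notin> N"
    using N by (intro AE_not_in) (simp add: negligible_iff_null_sets)
  then have "AE x in lborel. (\<lambda>n. g n x) \<longlonglongrightarrow> f x"
    unfolding AE_completion_iff by eventually_elim (rule lim)
  with g show ?thesis by (rule that)
qed

text \<open>Truncates values as \<open>cutoff\<close> truncates the support. Both are continuous, so
  applied to a continuous function they give a member of \<open>Cc\<close>.\<close>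

definition clip :: "real \<Rightarrow> real \<Rightarrow> real" where
  "clip k y = max (- k) (min k y)"

definition cutoff :: "real \<Rightarrow> 'a::euclidean_space \<Rightarrow> real" where
  "cutoff k p = max 0 (min 1 (k + 1 - norm p))"

lemma clip_cutoff_bound:
  assumes "k \<ge> 0"
  shows "\<bar>clip k y * cutoff k p\<bar> \<le> k * indicator (cball 0 (k + 1)) p" "\<bar>clip k y * cutoff k p\<bar> \<le> \<bar>y\<bar>"
proof -
  have c: "0 \<le> cutoff k p" "cutoff k p \<le> 1" "norm p > k + 1 \<Longrightarrow> cutoff k p = 0"
    by (auto simp: cutoff_def)
  have d: "\<bar>clip k y\<bar> \<le> k" "\<bar>clip k y\<bar> \<le> \<bar>y\<bar>"
    using assms by (auto simp: clip_def max_def min_def)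
  show "\<bar>clip k y * cutoff k p\<bar> \<le> k * indicator (cball 0 (k + 1)) p"
  proof (cases "norm p \<le> k + 1")
    case True
    have "\<bar>clip k y\<bar> * \<bar>cutoff k p\<bar> \<le> k * 1" using c d assms by (intro mult_mono) auto
    then show ?thesis using True by (simp add: abs_mult)
  next
    case False
    then show ?thesis using c by simp
  qed
  have "\<bar>clip k y\<bar> * \<bar>cutoff k p\<bar> \<le> \<bar>y\<bar> * 1" using c d by (intro mult_mono) auto
  then show "\<bar>clip k y * cutoff k p\<bar> \<le> \<bar>y\<bar>" by (simp add: abs_mult)
qed

text \<open>Taking f as its own dual function. The continuous approximations of f have no common
  majorant, so they are first truncated at level k, with a multiple of the indicator of a ball as
  majorant; then k tends to infinity with majorant |f|.\<close>

lemma quadratic_inequality_extend: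
  fixes f :: "'a::euclidean_space \<Rightarrow> real"
  assumes f: "L2_fun f" "integrable lborel f"
    and ineq: "\<And>\<psi>. Cc \<psi> \<Longrightarrow>
      (\<integral>p. f p * \<psi> p \<partial>lborel) \<le> a * (\<integral>p. (\<psi> p)\<^sup>2 \<partial>lborel) + b * (\<integral>p. \<bar>\<psi> p\<bar> \<partial>lborel) + c"
  shows "(\<integral>p. (f p)\<^sup>2 \<partial>lborel) \<le> a * (\<integral>p. (f p)\<^sup>2 \<partial>lborel) + b * (\<integral>p. \<bar>f p\<bar> \<partial>lborel) + c"
proof -
  have fm [measurable]: "f \<in> borel_measurable borel" using f by (simp add: L2_fun_real)
  obtain g where g: "\<And>n. continuous_on UNIV (g n)" and lim: "AE x in lborel. (\<lambda>n::nat. g n x) \<longlonglongrightarrow> f x"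
    using borel_AE_limit_continuous[OF fm] by metis
  have clip_cont: "continuous_on UNIV (clip k)" for k
    unfolding clip_def by (intro continuous_intros)
  have cut_cont: "continuous_on UNIV (cutoff k :: 'a \<Rightarrow> real)" for k
    unfolding cutoff_def by (intro continuous_intros)
  have [measurable]: "clip k \<in> borel_measurable borel" "(cutoff k :: 'a \<Rightarrow> real) \<in> borel_measurable borel"
      "g n \<in> borel_measurable borel" for k n
    by (rule borel_measurable_continuous_onI, rule clip_cont cut_cont g)+
  have step: "(\<integral>p. f p * (clip k (f p) * cutoff k p) \<partial>lborel) \<le> a * (\<integral>p. (clip k (f p) * cutoff k p)\<^sup>2 \<partial>lborel)
      + b * (\<integral>p. \<bar>clip k (f p) * cutoff k p\<bar> \<partial>lborel) + c" if k: "k \<ge> 0" for k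
  proof (rule quadratic_inequality_limit[where \<psi> = "\<lambda>n p. clip k (g n p) * cutoff k p"
        and w = "\<lambda>p. k * indicator (cball 0 (k + 1)) p"])
    have ind: "integrable lborel (indicator (cball 0 (k + 1)) :: 'a \<Rightarrow> real)"
      using emeasure_lborel_cball_finite by (intro integrable_real_indicator) auto
    show "AE p in lborel. (\<lambda>n. clip k (g n p) * cutoff k p) \<longlonglongrightarrow> clip k (f p) * cutoff k p"
      using lim
    proof eventually_elim
      fix p assume "(\<lambda>n. g n p) \<longlonglongrightarrow> f p"
      moreover have "isCont (clip k) (f p)"
        using clip_cont by (simp add: continuous_on_eq_continuous_at)
      ultimately show "(\<lambda>n. clip k (g n p) * cutoff k p) \<longlonglongrightarrow> clip k (f p) * cutoff k p"
        by (intro tendsto_mult_right isCont_tendsto_compose[where g = "clip k"])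
    qed
    show "\<bar>clip k (g n p) * cutoff k p\<bar> \<le> k * indicator (cball 0 (k + 1)) p" for n p
      by (rule clip_cutoff_bound(1)[OF k])
    show "integrable lborel (\<lambda>p :: 'a. k * indicator (cball 0 (k + 1)) p)"
      using ind by simp
    have "(\<lambda>p :: 'a. (k * indicator (cball 0 (k + 1)) p)\<^sup>2) = (\<lambda>p. k\<^sup>2 * indicator (cball 0 (k + 1)) p)"
      by (auto simp: indicator_def)
    then show "integrable lborel (\<lambda>p :: 'a. (k * indicator (cball 0 (k + 1)) p)\<^sup>2)"
      using ind by simp
    have "integrable lborel (\<lambda>p. \<bar>f p\<bar> * indicator (cball 0 (k + 1)) p)"
      using f(2) by (intro integrable_real_mult_indicator) auto
    from integrable_mult_right[OF this, of k]
    show "integrable lborel (\<lambda>p. \<bar>f p\<bar> * (k * indicator (cball 0 (k + 1)) p))"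
      by (simp add: mult_ac)
    have "Cc (\<lambda>p. clip k (g n p) * cutoff k p)" for n
      unfolding Cc_def
    proof (intro conjI exI allI impI)
      show "continuous_on UNIV (\<lambda>p. clip k (g n p) * cutoff k p)"
        by (intro continuous_on_mult cut_cont continuous_on_compose2[OF clip_cont g]) simp
      show "norm p \<le> k + 1" if "clip k (g n p) * cutoff k p \<noteq> 0" for p
        using that by (auto simp: cutoff_def)
    qed
    then show "(\<integral>p. f p * (clip k (g n p) * cutoff k p) \<partial>lborel) \<le> a * (\<integral>p. (clip k (g n p) * cutoff k p)\<^sup>2 \<partial>lborel)
      + b * (\<integral>p. \<bar>clip k (g n p) * cutoff k p\<bar> \<partial>lborel) + c" for n
      by (rule ineq)
  qed measurable
  have "(\<integral>p. f p * f p \<partial>lborel) \<le> a * (\<integral>p. (f p)\<^sup>2 \<partial>lborel) + b * (\<integral>p. \<bar>f p\<bar> \<partial>lborel) + c"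
  proof (rule quadratic_inequality_limit[where \<psi> = "\<lambda>n p. clip (real n) (f p) * cutoff (real n) p"
        and w = "\<lambda>p. \<bar>f p\<bar>"])
    have "(\<lambda>n. clip (real n) (f p) * cutoff (real n) p) \<longlonglongrightarrow> f p" for p
    proof (rule tendsto_eventually)
      \<comment> \<open>From this index on neither truncation acts at p, so the sequence is
        eventually constant.\<close>
      obtain m :: nat where m: "max \<bar>f p\<bar> (norm p) \<le> real m" using real_arch_simple by blast
      have "clip (real n) (f p) * cutoff (real n) p = f p" if "m \<le> n" for n
      proof -
        have "\<bar>f p\<bar> \<le> real n" "norm p \<le> real n" using m that by auto
        then show ?thesis by (auto simp: clip_def cutoff_def)
      qed
      then show "\<forall>\<^sub>F n in sequentially. clip (real n) (f p) * cutoff (real n) p = f p"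
        unfolding eventually_sequentially by blast
    qed
    then show "AE p in lborel. (\<lambda>n. clip (real n) (f p) * cutoff (real n) p) \<longlonglongrightarrow> f p" by simp
    show "\<bar>clip (real n) (f p) * cutoff (real n) p\<bar> \<le> \<bar>f p\<bar>" for n p
      by (rule clip_cutoff_bound(2)) simp
    show "integrable lborel (\<lambda>p. \<bar>f p\<bar>\<^sup>2)" "integrable lborel (\<lambda>p. \<bar>f p\<bar> * \<bar>f p\<bar>)"
      using f(1) by (simp_all add: L2_fun_real power2_eq_square)
  qed (use f(2) step in auto)
  then show ?thesis by (simp add: power2_eq_square)
qed

text \<open>Choose \<open>l\<close> and \<open>r\<close> so that each of the first two terms is at
  most a quarter of N^2. Half of N^2 is absorbed, and the surviving L^1 term gives N^(Q+2) \<le>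
  const A^2 D^Q, whose Q-th root is the claim.\<close>

lemma nash_optimisation:
  fixes N D A C :: real and Q :: nat
  assumes nn: "N \<ge> 0" "D \<ge> 0" "A \<ge> 0" "C > 0" and Q: "Q > 0"
    and ineq: "\<And>r l. r > 0 \<Longrightarrow> l > 0 \<Longrightarrow> N\<^sup>2 \<le> C * (r * (l * N\<^sup>2 + D\<^sup>2 / l) + A * A / r ^ Q)"
  shows "N powr (1 + 2 / real Q) \<le> (2 * C * (4 * C) ^ Q) powr (1 / real Q) * D * A powr (2 / real Q)"
proof (cases "N = 0")
  case True
  then show ?thesis using nn by simp
next
  case False
  then have N: "N > 0" using nn by simp
  let ?c = "(2 * C * (4 * C) ^ Q) powr (1 / real Q)"
  \<comment> \<open>Since \<open>D\<close> may be 0, the optimal scale is formed with some E > D,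
    and E tends to D at the end.\<close>
  have main: "N powr (1 + 2 / real Q) \<le> (?c * A powr (2 / real Q)) * E" if E: "E > D" for E
  proof -
    have E0: "E > 0" using E nn by simp
    \<comment> \<open>With \<open>l = 1 / (4 * C * r)\<close> the first term is N^2/4 for every r;
      this r makes the second, 4 (C r)^2 D^2, at most N^2/4.\<close>
    define r where "r = N / (4 * C * E)"
    have r: "r > 0" using N nn E0 by (simp add: r_def)
    have l: "1 / (4 * C * r) > 0" using nn r by simp
    have "C * (r * (1 / (4 * C * r) * N\<^sup>2)) = N\<^sup>2 / 4"
      using nn r by (simp add: field_simps)
    moreover have "C * (r * (D\<^sup>2 / (1 / (4 * C * r)))) \<le> N\<^sup>2 / 4"
    proof -
      have "C * (r * (D\<^sup>2 / (1 / (4 * C * r)))) = 4 * (C * r) ^ 2 * D\<^sup>2"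
        by (simp add: power2_eq_square)
      also have "\<dots> \<le> 4 * (C * r) ^ 2 * E\<^sup>2"
        using E nn by (intro mult_left_mono power_mono) auto
      also have "\<dots> = N\<^sup>2 / 4"
        using nn E0 by (simp add: r_def field_simps power2_eq_square)
      finally show ?thesis .
    qed
    moreover have "N\<^sup>2 \<le> C * (r * (1 / (4 * C * r) * N\<^sup>2)) + C * (r * (D\<^sup>2 / (1 / (4 * C * r)))) + C * (A * A / r ^ Q)"
      using ineq[OF r l] by (simp only: distrib_left)
    ultimately have "N\<^sup>2 \<le> 2 * (C * (A * A / r ^ Q))" by linarith
    then have "N\<^sup>2 * r ^ Q \<le> 2 * C * A\<^sup>2"
      using r by (simp add: field_simps power2_eq_square)
    then have "N\<^sup>2 * N ^ Q \<le> 2 * C * A\<^sup>2 * (4 * C * E) ^ Q"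
      using nn E0 by (simp add: r_def power_divide field_simps)
    then have "N ^ (Q + 2) \<le> 2 * C * (4 * C) ^ Q * A\<^sup>2 * E ^ Q"
      by (simp only: power_add power_mult_distrib mult_ac)
    then have "(N ^ (Q + 2)) powr (1 / real Q) \<le> (2 * C * (4 * C) ^ Q * A\<^sup>2 * E ^ Q) powr (1 / real Q)"
      using N by (intro powr_mono2) auto
    also have "(2 * C * (4 * C) ^ Q * A\<^sup>2 * E ^ Q) powr (1 / real Q) = ?c * (A\<^sup>2) powr (1 / real Q) * (E ^ Q) powr (1 / real Q)"
      using nn E0 by (simp add: powr_mult)
    also have "(E ^ Q) powr (1 / real Q) = E"
      using E0 Q by (simp add: powr_realpow[symmetric] powr_powr)
    also have "(A\<^sup>2) powr (1 / real Q) = A powr (2 / real Q)"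
      using nn by (cases "A = 0") (auto simp: powr_realpow[symmetric] powr_powr powr_numeral[symmetric] simp del: powr_numeral)
    also have "(N ^ (Q + 2)) powr (1 / real Q) = N powr (1 + 2 / real Q)"
    proof -
      have "(N ^ (Q + 2)) powr (1 / real Q) = N powr (real (Q + 2) * (1 / real Q))"
        using N by (simp only: powr_realpow[symmetric] powr_powr)
      also have "real (Q + 2) * (1 / real Q) = 1 + 2 / real Q" using Q by (simp add: field_simps)
      finally show ?thesis .
    qed
    finally show ?thesis by (simp add: mult_ac)
  qed
  have "((\<lambda>E. (?c * A powr (2 / real Q)) * E) \<longlongrightarrow> (?c * A powr (2 / real Q)) * D) (at_right D)"
    by (intro tendsto_intros)
  moreover have "\<forall>\<^sub>F E in at_right D. N powr (1 + 2 / real Q) \<le> (?c * A powr (2 / real Q)) * E"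
    using main by (auto simp: eventually_at_right_field intro: exI[of _ "D + 1"])
  ultimately have "N powr (1 + 2 / real Q) \<le> (?c * A powr (2 / real Q)) * D"
    by (rule tendsto_lowerbound) simp
  then show ?thesis by (simp add: mult_ac)
qed

theorem mainTheorem5:
  "\<exists>C>0. \<forall>(f :: 'n::finite phase \<Rightarrow> real) (G :: 'n phase \<Rightarrow> real ^ 'n) (S :: 'n phase \<Rightarrow> real ^ 'n).
     L2_fun f \<and> weak_grad_v f G \<and> L2_fun G \<and> integrable lborel f \<and>
     L2_fun S \<and> kinetic_eq f S \<longrightarrow>
     L2_norm_fun f powr (1 + 2 / (2 + 4 * real CARD('n)))
       \<le> C * sqrt ((L2_norm_fun G)\<^sup>2 + (L2_norm_fun S)\<^sup>2)
           * L1_norm_fun f powr (2 / (2 + 4 * real CARD('n)))"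
proof -
  let ?Q = "kdim TYPE('n)"
  have Q: "real ?Q = 2 + 4 * real CARD('n)" "?Q > 0" by (simp_all add: kdim_def)
  obtain C where C: "C > 0" and test:
    "\<And>(f :: 'n phase \<Rightarrow> real) G S \<psi> r l. L2_fun f \<Longrightarrow> integrable lborel f \<Longrightarrow> L2_fun G \<Longrightarrow> L2_fun S \<Longrightarrow>
      weak_grad_v f G \<Longrightarrow> kinetic_eq f S \<Longrightarrow> Cc \<psi> \<Longrightarrow> r > 0 \<Longrightarrow> l > 0 \<Longrightarrow>
      (\<integral>z. f z * \<psi> z \<partial>lborel) \<le> C * (r * (l * (\<integral>p. (\<psi> p)\<^sup>2 \<partial>lborel)
          + ((\<integral>p. (norm (G p))\<^sup>2 \<partial>lborel) + (\<integral>p. (norm (S p))\<^sup>2 \<partial>lborel)) / l)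
        + (\<integral>z. \<bar>f z\<bar> \<partial>lborel) * (\<integral>p. \<bar>\<psi> p\<bar> \<partial>lborel) / r ^ ?Q)"
    by (rule kinetic_test_inequality) (rule that)
  show ?thesis
  proof (intro exI conjI allI impI)
    show "(2 * C * (4 * C) ^ ?Q) powr (1 / real ?Q) > 0" using C by simp
    fix f :: "'n phase \<Rightarrow> real" and G S :: "'n phase \<Rightarrow> real ^ 'n"
    assume "L2_fun f \<and> weak_grad_v f G \<and> L2_fun G \<and> integrable lborel f \<and> L2_fun S \<and> kinetic_eq f S"
    then have f: "L2_fun f" "integrable lborel f" and G: "L2_fun G" and S: "L2_fun S"
      and wg: "weak_grad_v f G" and ke: "kinetic_eq f S" by simp_all
    define D where "D = sqrt ((L2_norm_fun G)\<^sup>2 + (L2_norm_fun S)\<^sup>2)"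
    have D2: "D\<^sup>2 = (\<integral>p. (norm (G p))\<^sup>2 \<partial>lborel) + (\<integral>p. (norm (S p))\<^sup>2 \<partial>lborel)"
      by (simp add: D_def L2_norm_fun_def)
    have N2: "(L2_norm_fun f)\<^sup>2 = (\<integral>p. (f p)\<^sup>2 \<partial>lborel)"
      by (simp add: L2_norm_fun_def)
    let ?A = "L1_norm_fun f"
    have "L2_norm_fun f powr (1 + 2 / real ?Q)
        \<le> (2 * C * (4 * C) ^ ?Q) powr (1 / real ?Q) * D * ?A powr (2 / real ?Q)"
    proof (rule nash_optimisation)
      show "L2_norm_fun f \<ge> 0" "D \<ge> 0" "?A \<ge> 0" by (simp_all add: L2_norm_fun_def D_def L1_norm_fun_def)
      fix r l :: real assume r: "r > 0" and l: "l > 0"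
      \<comment> \<open>For fixed \<open>r\<close> and \<open>l\<close> the test inequality has the
        shape that extends to \<psi> = f: a quadratic term, an L^1 term and a constant.\<close>
      have "(\<integral>p. f p * \<psi> p \<partial>lborel) \<le> (C * r * l) * (\<integral>p. (\<psi> p)\<^sup>2 \<partial>lborel)
          + (C * ?A / r ^ ?Q) * (\<integral>p. \<bar>\<psi> p\<bar> \<partial>lborel) + C * r * (D\<^sup>2 / l)" if "Cc \<psi>" for \<psi>
        using test[OF f G S wg ke that r l] unfolding D2[symmetric] L1_norm_fun_def[symmetric]
        by (simp add: distrib_left mult_ac)
      from quadratic_inequality_extend[OF f this]
      have "(\<integral>p. (f p)\<^sup>2 \<partial>lborel) \<le> (C * r * l) * (\<integral>p. (f p)\<^sup>2 \<partial>lborel)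
          + (C * ?A / r ^ ?Q) * ?A + C * r * (D\<^sup>2 / l)"
        by (simp add: L1_norm_fun_def)
      then show "(L2_norm_fun f)\<^sup>2 \<le> C * (r * (l * (L2_norm_fun f)\<^sup>2 + D\<^sup>2 / l) + ?A * ?A / r ^ ?Q)"
        unfolding N2 by (simp add: distrib_left mult_ac)
    qed (use C Q in simp_all)
    then show "L2_norm_fun f powr (1 + 2 / (2 + 4 * real CARD('n)))
       \<le> (2 * C * (4 * C) ^ ?Q) powr (1 / real ?Q) * sqrt ((L2_norm_fun G)\<^sup>2 + (L2_norm_fun S)\<^sup>2)
           * L1_norm_fun f powr (2 / (2 + 4 * real CARD('n)))"
      unfolding Q(1) D_def .
  qed
qed

end
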